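(* Let $|\cdot|$ be an absolute and normalized norm on $\mathbb{R}^2$. Let $X$ be a (real or complex) Banach space that can be decomposed as $X=M\oplus N$ for certain subspaces $M$ and $N$ such that $$\|m+n\| = \big|(\|m\|,\|n\|)\big| \qquad \text{for all } m\in M,\ n\in N.$$ Then $X$ has the approximate hyperplane series property (AHSp) if and only if both $M$ and $N$ have the AHSp. In such case, both subspaces satisfy the AHSp with the same function $\eta$ (that is, there is a function $\eta:(0,1)\to(0,1)$ such that both $M$ and $N$ have the AHSp with the function $\eta$).
   Context: For a normed space $X$, $B_X$ and $S_X$ denote its closed unit ball and unit sphere, and $X^*$ its topological dual. A norm $|\cdot|$ on $\mathbb{R}^2$ is absolute if $|(r,s)|=|(|r|,|s|)|$ for all $r,s\in\mathbb{R}$; it is normalized if $|(1,0)|=|(0,1)|=1$. A convex series is a series $\sum\alpha_n$ with $0\le\alpha_n\le1$ for each $n\in\mathbb{N}$ and $\sum_{n=1}^\infty\alpha_n=1$. A Banach space $X$ has the approximate hyperplane series property (AHSp) if for every $0<\varepsilon<1$ there exists $0<\eta<\varepsilon$ such that for every sequence $\{x_n\}$ in $S_X$ and every convex series $\sum\alpha_n$ with $\big\|\sum_{n=1}^\infty\alpha_nx_n\big\|>1-\eta$, there exist a subset $A\subset\mathbb{N}$ and a subset $\{z_k:k\in A\}\subset S_X$ satisfying: (1) $\sum_{k\in A}\alpha_k>1-\varepsilon$; (2) $\|z_k-x_k\|<\varepsilon$ for all $k\in A$; (3) there is $x^*\in S_{X^*}$ such that $x^*(z_k)=1$ for every $k\in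 A$. If $\eta=\eta(\varepsilon)$ is such a choice for each $\varepsilon\in(0,1)$, we say that $X$ has the AHSp with the function $\eta$. *)

theory Defs
  imports "HOL-Analysis.Analysis"
begin

section \<open>Absolute normalized norms on the plane\<close>

definition is_norm :: "('v::real_vector \<Rightarrow> real) \<Rightarrow> bool" where
  "is_norm p \<longleftrightarrow>
     (\<forall>v. 0 \<le> p v) \<and> (\<forall>v. p v = 0 \<longleftrightarrow> v = 0) \<and>
     (\<forall>c v. p (c *\<^sub>R v) = \<bar>c\<bar> * p v) \<and> (\<forall>v w. p (v + w) \<le> p v + p w)"

definition absolute_norm :: "(real \<times> real \<Rightarrow> real) \<Rightarrow> bool" where
  "absolute_norm p \<longleftrightarrow> is_norm p \<and> (\<forall>r s. p (r, s) = p (\<bar>r\<bar>, \<bar>s\<bar>))"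

definition normalized_norm :: "(real \<times> real \<Rightarrow> real) \<Rightarrow> bool" where
  "normalized_norm p \<longleftrightarrow> p (1, 0) = 1 \<and> p (0, 1) = 1"


section \<open>Real and complex Banach spaces\<close>

text \<open>The scalar fields: up to isometric isomorphism, this class contains exactly the
  real and the complex numbers. It serves to treat both cases in one statement.\<close>

class real_or_complex = real_normed_field +
  assumes real_or_complex:
    "(\<forall>z. \<exists>a. z = a *\<^sub>R 1) \<or>
     (\<exists>i. i * i = - 1 \<and> (\<forall>z. \<exists>a b. z = a *\<^sub>R 1 + b *\<^sub>R i) \<and>
          (\<forall>a b. norm (a *\<^sub>R 1 + b *\<^sub>R i) = sqrt (a\<^sup>2 + b\<^sup>2)))"

instance real :: real_or_complex
  by standard auto

instance complex :: real_or_complex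
proof
  have "\<forall>z. \<exists>a b. z = a *\<^sub>R 1 + b *\<^sub>R \<i>"
    by (metis complex_eq mult.commute mult.right_neutral scaleR_conv_of_real)
  moreover have "norm (a *\<^sub>R 1 + b *\<^sub>R \<i>) = sqrt (a\<^sup>2 + b\<^sup>2)" for a b
    by (simp add: cmod_def)
  ultimately show "(\<forall>z::complex. \<exists>a. z = a *\<^sub>R 1) \<or>
     (\<exists>i::complex. i * i = - 1 \<and> (\<forall>z. \<exists>a b. z = a *\<^sub>R 1 + b *\<^sub>R i) \<and>
          (\<forall>a b. norm (a *\<^sub>R 1 + b *\<^sub>R i) = sqrt (a\<^sup>2 + b\<^sup>2)))"
    by (intro disjI2 exI[of _ \<i>]) auto
qed

text \<open>The type class \<open>banach\<close> only provides multiplication by real scalars; \<open>smul\<close> is the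
  multiplication by scalars in the field \<open>'k\<close> and extends the real one. For \<open>'k = real\<close>
  this forces \<open>smul = scaleR\<close>.\<close>

locale banach_space_over = vector_space smul
  for smul :: "'k::real_or_complex \<Rightarrow> 'a::banach \<Rightarrow> 'a" +
  assumes smul_of_real: "smul (of_real r) x = r *\<^sub>R x"
    and norm_smul: "norm (smul c x) = norm c * norm x"

definition direct_sum_decomposition ::
    "('k::real_or_complex \<Rightarrow> 'a::banach \<Rightarrow> 'a) \<Rightarrow> 'a set \<Rightarrow> 'a set \<Rightarrow> bool" where
  "direct_sum_decomposition smul M N \<longleftrightarrow>
     module.subspace smul M \<and> module.subspace smul N \<and>
     {m + n | m n. m \<in> M \<and> n \<in> N} = UNIV \<and> M \<inter> N = {0}"


section \<open>The dual of a subspace\<close>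

text \<open>A subspace \<open>Y\<close> is a set, so its functionals are represented by functions on the whole
  type of which only the values on \<open>Y\<close> matter.\<close>

definition bounded_functional_on ::
    "('k::real_or_complex \<Rightarrow> 'a::banach \<Rightarrow> 'a) \<Rightarrow> 'a set \<Rightarrow> ('a \<Rightarrow> 'k) \<Rightarrow> bool" where
  "bounded_functional_on smul Y f \<longleftrightarrow>
     (\<forall>x\<in>Y. \<forall>y\<in>Y. f (x + y) = f x + f y) \<and>
     (\<forall>c. \<forall>x\<in>Y. f (smul c x) = c * f x) \<and>
     (\<exists>K. \<forall>x\<in>Y. norm (f x) \<le> K * norm x)"

definition dual_norm_on :: "'a::banach set \<Rightarrow> ('a \<Rightarrow> 'k::real_or_complex) \<Rightarrow> real" where
  "dual_norm_on Y f = (SUP x\<in>{x\<in>Y. norm x \<le> 1}. norm (f x))"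

definition dual_unit_sphere ::
    "('k::real_or_complex \<Rightarrow> 'a::banach \<Rightarrow> 'a) \<Rightarrow> 'a set \<Rightarrow> ('a \<Rightarrow> 'k) set" where
  "dual_unit_sphere smul Y = {f. bounded_functional_on smul Y f \<and> dual_norm_on Y f = 1}"


section \<open>The approximate hyperplane series property\<close>

definition convex_series :: "(nat \<Rightarrow> real) \<Rightarrow> bool" where
  "convex_series \<alpha> \<longleftrightarrow> (\<forall>n. 0 \<le> \<alpha> n \<and> \<alpha> n \<le> 1) \<and> \<alpha> sums 1"

definition AHSp_for ::
    "('k::real_or_complex \<Rightarrow> 'a::banach \<Rightarrow> 'a) \<Rightarrow> 'a set \<Rightarrow> real \<Rightarrow> real \<Rightarrow> bool" where
  "AHSp_for smul Y \<epsilon> \<eta> \<longleftrightarrow>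
     (\<forall>x \<alpha>. (\<forall>n. x n \<in> Y \<inter> sphere 0 1) \<longrightarrow> convex_series \<alpha> \<longrightarrow>
        norm (\<Sum>n. \<alpha> n *\<^sub>R x n) > 1 - \<eta> \<longrightarrow>
        (\<exists>A z. (\<forall>k\<in>A. z k \<in> Y \<inter> sphere 0 1) \<and>
           (\<Sum>\<^sub>\<infinity>k\<in>A. \<alpha> k) > 1 - \<epsilon> \<and>
           (\<forall>k\<in>A. norm (z k - x k) < \<epsilon>) \<and>
           (\<exists>f\<in>dual_unit_sphere smul Y. \<forall>k\<in>A. f (z k) = 1)))"

definition AHSp :: "('k::real_or_complex \<Rightarrow> 'a::banach \<Rightarrow> 'a) \<Rightarrow> 'a set \<Rightarrow> bool" where
  "AHSp smul Y \<longleftrightarrow>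
     (\<forall>\<epsilon>. 0 < \<epsilon> \<and> \<epsilon> < 1 \<longrightarrow> (\<exists>\<eta>. 0 < \<eta> \<and> \<eta> < \<epsilon> \<and> AHSp_for smul Y \<epsilon> \<eta>))"

definition AHSp_with ::
    "('k::real_or_complex \<Rightarrow> 'a::banach \<Rightarrow> 'a) \<Rightarrow> 'a set \<Rightarrow> (real \<Rightarrow> real) \<Rightarrow> bool" where
  "AHSp_with smul Y \<eta> \<longleftrightarrow>
     (\<forall>\<epsilon>. 0 < \<epsilon> \<and> \<epsilon> < 1 \<longrightarrow> 0 < \<eta> \<epsilon> \<and> \<eta> \<epsilon> < \<epsilon> \<and> AHSp_for smul Y \<epsilon> (\<eta> \<epsilon>))"

end

theory Submission
  imports Defs
begin

text \<open>Write \<open>x n = m n + k n\<close> with \<open>m n \<in> M\<close> and \<open>k n \<in> N\<close>. If \<open>\<Sum>n. \<alpha> n *\<^sub>R x n\<close>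
  has norm almost 1, then a functional \<open>(a, b)\<close> on the plane that norms the pair of norms of its
  two components is almost 1 at most of the pairs \<open>(norm (m n), norm (k n))\<close>, and
  \<open>a * (\<Sum>n. \<alpha> n * norm (m n))\<close> hardly exceeds \<open>a * norm (\<Sum>n. \<alpha> n *\<^sub>R m n)\<close>. The former moves
  the pairs to a common face of the unit ball of the plane, the latter aligns the directions of the
  \<open>m n\<close> by the AHSp of \<open>M\<close>, and likewise for \<open>N\<close>. Conversely, a functional on the sum that attains
  its norm at several unit vectors attains, on each summand, its norm in the directions of their
  components, provided that these do not vanish.\<close>

section \<open>Convex series\<close>

lemma convex_series_summable_on: "convex_series \<alpha> \<Longrightarrow> \<alpha> summable_on A"
  unfolding convex_series_def
  by (metis sums_nonneg_imp_has_sum has_sum_imp_summable summable_on_subset_banach subset_UNIV)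

lemma convex_series_infsum_UNIV: "convex_series \<alpha> \<Longrightarrow> infsum \<alpha> UNIV = 1"
  unfolding convex_series_def by (metis sums_nonneg_imp_has_sum infsumI)

lemma convex_series_infsum_Compl:
  assumes "convex_series \<alpha>"
  shows "infsum \<alpha> (- A) = 1 - infsum \<alpha> A"
proof -
  have "infsum \<alpha> (A \<union> - A) = infsum \<alpha> A + infsum \<alpha> (- A)"
    by (intro infsum_Un_disjoint convex_series_summable_on assms) auto
  then show ?thesis using convex_series_infsum_UNIV[OF assms] by simp
qed

lemma convex_series_infsum_Un_le:
  assumes "convex_series \<alpha>"
  shows "infsum \<alpha> (A \<union> B) \<le> infsum \<alpha> A + infsum \<alpha> B"
proof -
  have "infsum \<alpha> (A \<union> B) = infsum \<alpha> (A \<union> (B - A))" by (simp add: Un_Diff_cancel)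
  also have "\<dots> = infsum \<alpha> A + infsum \<alpha> (B - A)"
    by (intro infsum_Un_disjoint convex_series_summable_on assms) auto
  also have "infsum \<alpha> (B - A) \<le> infsum \<alpha> B"
    using assms
    by (intro infsum_mono_neutral convex_series_summable_on) (auto simp: convex_series_def)
  finally show ?thesis by simp
qed

text \<open>The union bound for the complements: index sets that carry almost all the weight keep
  this property under intersection.\<close>

lemma convex_series_infsum_Int_ge:
  assumes "convex_series \<alpha>"
  shows "infsum \<alpha> (A \<inter> B) \<ge> infsum \<alpha> A + infsum \<alpha> B - 1"
  using convex_series_infsum_Un_le[OF assms, of "- A" "- B"]
  unfolding Compl_Int[symmetric] convex_series_infsum_Compl[OF assms] by simp

lemma convex_series_summable_scaleR:
  fixes x :: "nat \<Rightarrow> 'b::banach"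
  assumes "convex_series \<alpha>" and "\<And>n. norm (x n) \<le> K"
  shows "summable (\<lambda>n. \<alpha> n *\<^sub>R x n)"
proof (rule summable_comparison_test)
  show "summable (\<lambda>n. \<alpha> n * K)"
    using assms(1) by (auto simp: convex_series_def intro: summable_mult2 sums_summable)
  show "\<exists>N. \<forall>n\<ge>N. norm (\<alpha> n *\<^sub>R x n) \<le> \<alpha> n * K"
    using assms by (auto simp: convex_series_def intro: mult_left_mono)
qed

lemma convex_series_norm_suminf_le:
  fixes x :: "nat \<Rightarrow> 'b::banach"
  assumes "convex_series \<alpha>" and "\<And>n. norm (x n) \<le> K"
  shows "norm (\<Sum>n. \<alpha> n *\<^sub>R x n) \<le> (\<Sum>n. \<alpha> n * norm (x n))"
proof -
  have "summable (\<lambda>n. norm (\<alpha> n *\<^sub>R x n))"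
    using convex_series_summable_scaleR[OF assms(1), of "\<lambda>n. norm (x n)" K] assms
    by (simp add: convex_series_def)
  from summable_norm[OF this] show ?thesis using assms(1) by (simp add: convex_series_def)
qed

text \<open>Markov's inequality, with \<alpha> as a probability measure on the naturals.\<close>

lemma convex_series_markov:
  fixes g :: "nat \<Rightarrow> real"
  assumes \<alpha>: "convex_series \<alpha>" and g: "\<And>n. 0 \<le> g n" and "summable (\<lambda>n. \<alpha> n * g n)"
    and c: "c > 0"
  shows "infsum \<alpha> {n. c \<le> g n} \<le> (\<Sum>n. \<alpha> n * g n) / c"
proof -
  have "((\<lambda>n. \<alpha> n * g n) has_sum (\<Sum>n. \<alpha> n * g n)) UNIV"
    using assms by (intro sums_nonneg_imp_has_sum summable_sums) (auto simp: convex_series_def)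
  then have *: "((\<lambda>n. \<alpha> n * g n * inverse c) has_sum (\<Sum>n. \<alpha> n * g n) * inverse c) UNIV"
    by (rule has_sum_cmult_left)
  have "infsum \<alpha> {n. c \<le> g n} \<le> infsum (\<lambda>n. \<alpha> n * g n * inverse c) UNIV"
  proof (rule infsum_mono_neutral)
    show "\<alpha> summable_on {n. c \<le> g n}" by (rule convex_series_summable_on[OF \<alpha>])
    show "(\<lambda>n. \<alpha> n * g n * inverse c) summable_on UNIV" using * by (rule has_sum_imp_summable)
    show "\<alpha> n \<le> \<alpha> n * g n * inverse c" if "n \<in> {n. c \<le> g n} \<inter> UNIV" for n
    proof -
      have "\<alpha> n * 1 \<le> \<alpha> n * (g n / c)"
        using that \<alpha> c by (intro mult_left_mono) (auto simp: convex_series_def)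
      then show ?thesis by (simp add: field_simps)
    qed
    show "0 \<le> \<alpha> n * g n * inverse c" for n
      using \<alpha> g[of n] c by (simp add: convex_series_def)
  qed auto
  with infsumI[OF *] show ?thesis by (simp add: field_simps)
qed


section \<open>Duality and faces in the plane\<close>

locale absolute_normalized =
  fixes p :: "real \<times> real \<Rightarrow> real"
  assumes absolute: "absolute_norm p" and normalized: "normalized_norm p"
begin

section \<open>Elementary estimates for an absolute norm on the plane\<close>

lemma p_nonneg: "0 \<le> p v"
  using absolute unfolding absolute_norm_def is_norm_def by blast

lemma p_eq_0_iff: "p v = 0 \<longleftrightarrow> v = 0"
  using absolute unfolding absolute_norm_def is_norm_def by blast

lemma p_scaleR: "p (c *\<^sub>R v) = \<bar>c\<bar> * p v"
  using absolute unfolding absolute_norm_def is_norm_def by blast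

lemma p_triangle: "p (v + w) \<le> p v + p w"
  using absolute unfolding absolute_norm_def is_norm_def by blast

lemma p_abs: "p (\<bar>r\<bar>, \<bar>s\<bar>) = p (r, s)"
  using absolute by (simp add: absolute_norm_def)

lemma p_axes: "p (r, 0) = \<bar>r\<bar>" "p (0, s) = \<bar>s\<bar>"
  using p_scaleR[of r "(1, 0)"] p_scaleR[of s "(0, 1)"] normalized
  by (simp_all add: normalized_norm_def)

lemma p_le_sum: "p (r, s) \<le> \<bar>r\<bar> + \<bar>s\<bar>"
  using p_triangle[of "(r, 0)" "(0, s)"] by (simp add: p_axes)

text \<open>Since \<open>(r, s)\<close> and \<open>(r, - s)\<close> have the same norm, adding them
  isolates the first coordinate; likewise for the second.\<close>

lemma p_ge_abs: "\<bar>r\<bar> \<le> p (r, s)" "\<bar>s\<bar> \<le> p (r, s)"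
proof -
  have "p (r, - s) = p (r, s)" "p (- r, s) = p (r, s)"
    using p_abs[of r "- s"] p_abs[of r s] p_abs[of "- r" s] by simp_all
  then show "\<bar>r\<bar> \<le> p (r, s)" "\<bar>s\<bar> \<le> p (r, s)"
    using p_triangle[of "(r, s)" "(r, - s)"] p_triangle[of "(r, s)" "(- r, s)"]
    by (simp_all add: p_axes)
qed

text \<open>One coordinate is changed at a time: \<open>(r, s)\<close> is a convex combination of
  \<open>(r', s)\<close> and \<open>(- r', s)\<close>, which have equal norm.\<close>

lemma p_mono:
  assumes "\<bar>r\<bar> \<le> r'" and "\<bar>s\<bar> \<le> s'"
  shows "p (r, s) \<le> p (r', s')"
proof -
  have *: "p (r, s) \<le> p (r', s)" if "\<bar>r\<bar> \<le> r'" for r r' s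
  proof (cases "r' = 0")
    case False
    then have pos: "r' > 0" using that by simp
    define t where "t = (1 + r / r') / 2"
    have t: "0 \<le> t" "t \<le> 1" using that pos by (auto simp: t_def field_simps abs_le_iff)
    have eq: "(r, s) = t *\<^sub>R (r', s) + (1 - t) *\<^sub>R (- r', s)"
      using pos by (simp add: t_def field_simps)
    have "p (r, s) \<le> t * p (r', s) + (1 - t) * p (- r', s)"
      unfolding eq using p_triangle[of "t *\<^sub>R (r', s)" "(1 - t) *\<^sub>R (- r', s)"] t
      by (simp only: p_scaleR)
    also have "p (- r', s) = p (r', s)" using p_abs[of "- r'" s] p_abs[of r' s] by simp
    finally show ?thesis by (simp add: algebra_simps)
  qed (use that in simp)
  have **: "p (r, s) \<le> p (r, s')" if "\<bar>s\<bar> \<le> s'" for r s s'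
  proof (cases "s' = 0")
    case False
    then have pos: "s' > 0" using that by simp
    define t where "t = (1 + s / s') / 2"
    have t: "0 \<le> t" "t \<le> 1" using that pos by (auto simp: t_def field_simps abs_le_iff)
    have eq: "(r, s) = t *\<^sub>R (r, s') + (1 - t) *\<^sub>R (r, - s')"
      using pos by (simp add: t_def field_simps)
    have "p (r, s) \<le> t * p (r, s') + (1 - t) * p (r, - s')"
      unfolding eq using p_triangle[of "t *\<^sub>R (r, s')" "(1 - t) *\<^sub>R (r, - s')"] t
      by (simp only: p_scaleR)
    also have "p (r, - s') = p (r, s')" using p_abs[of r "- s'"] p_abs[of r s'] by simp
    finally show ?thesis by (simp add: algebra_simps)
  qed (use that in simp)
  show ?thesis using *[OF assms(1), of s] **[OF assms(2), of r'] by simp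
qed

text \<open>The triangle inequality and \<open>p_le_sum\<close> make \<open>p\<close> Lipschitz with
  constant 2 for the Euclidean distance.\<close>

lemma continuous_on_p: "continuous_on S p"
proof (rule continuous_on_subset[OF _ subset_UNIV], unfold continuous_on_iff, intro ballI allI impI)
  fix v :: "real \<times> real" and e :: real assume e: "e > 0"
  have "dist (p w) (p v) < e" if "dist w v < e / 2" for w
  proof -
    have le: "p (x - y) \<le> 2 * dist x y" for x y
      using p_le_sum[of "fst (x - y)" "snd (x - y)"] dist_fst_le[of x y] dist_snd_le[of x y]
      by (simp add: dist_real_def del: fst_diff snd_diff) (simp add: minus_prod_def)
    have "p w - p v \<le> p (w - v)" "p v - p w \<le> p (v - w)"
      using p_triangle[of "w - v" v] p_triangle[of "v - w" w] by auto
    then show ?thesis using le[of w v] le[of v w] that by (simp add: dist_real_def dist_commute)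
  qed
  then show "\<exists>d>0. \<forall>w\<in>UNIV. dist w v < d \<longrightarrow> dist (p w) (p v) < e"
    using e by (intro exI[of _ "e / 2"]) auto
qed

text \<open>The part of the dual unit ball in the nonnegative quadrant, \<open>(a, b)\<close>
  standing for the functional that sends \<open>(r, s)\<close> to \<open>a * r + b * s\<close>. It
  suffices because only pairs of norms are tested.\<close>

definition dual_ball :: "(real \<times> real) set" where
  "dual_ball = {(a, b). 0 \<le> a \<and> 0 \<le> b \<and> (\<forall>r s. a * r + b * s \<le> p (r, s))}"

definition positive_ball :: "(real \<times> real) set" where
  "positive_ball = {(r, s). 0 \<le> r \<and> 0 \<le> s \<and> p (r, s) \<le> 1}"

lemma dual_ball_le_1: "(a, b) \<in> dual_ball \<Longrightarrow> a \<le> 1 \<and> b \<le> 1"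
proof -
  assume "(a, b) \<in> dual_ball"
  then have "a * 1 + b * 0 \<le> p (1, 0)" "a * 0 + b * 1 \<le> p (0, 1)"
    unfolding dual_ball_def by blast+
  then show ?thesis by (simp add: p_axes)
qed

lemma compact_dual_ball: "compact dual_ball"
proof -
  have "dual_ball = {v. 0 \<le> fst v} \<inter> {v. 0 \<le> snd v} \<inter>
    (\<Inter>w. {v. fst v * fst w + snd v * snd w \<le> p w})"
    by (auto simp: dual_ball_def)
  moreover have "closed \<dots>"
    by (intro closed_Int closed_INT ballI closed_Collect_le continuous_intros)
  moreover have "dual_ball \<subseteq> cbox (0, 0) (1, 1)"
    using dual_ball_le_1 by (auto simp: dual_ball_def cbox_Pair_eq)
  ultimately show ?thesis
    by (metis bounded_cbox bounded_subset compact_eq_bounded_closed)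
qed

lemma compact_positive_ball: "compact positive_ball"
proof -
  have "positive_ball = {v. 0 \<le> fst v} \<inter> {v. 0 \<le> snd v} \<inter> {v. p v \<le> 1}"
    by (auto simp: positive_ball_def)
  moreover have "closed \<dots>"
    by (intro closed_Int closed_Collect_le continuous_intros continuous_on_p)
  moreover have "positive_ball \<subseteq> cbox (0, 0) (1, 1)"
    by (auto simp: positive_ball_def cbox_Pair_eq)
      (use p_ge_abs in \<open>(meson abs_ge_self order_trans)+\<close>)
  ultimately show ?thesis
    by (metis bounded_cbox bounded_subset compact_eq_bounded_closed)
qed

text \<open>Hahn--Banach in the plane: a line separates \<open>(r, s)\<close> from the open ball of
  radius \<open>p (r, s)\<close>. As \<open>p\<close> is absolute, the coefficients of the line may
  be replaced by their absolute values.\<close>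

lemma dual_ball_norming:
  assumes "0 \<le> r" "0 \<le> s"
  shows "\<exists>(a, b)\<in>dual_ball. a * r + b * s = p (r, s)"
proof (cases "p (r, s) = 0")
  case True
  then have "r = 0" "s = 0" by (simp_all add: p_eq_0_iff zero_prod_def)
  then show ?thesis using p_nonneg True
    by (intro bexI[of _ "(0, 0)"]) (auto simp: dual_ball_def)
next
  case False
  define P where "P = p (r, s)"
  have P: "P > 0" using False p_nonneg[of "(r, s)"] by (simp add: P_def)
  have cx: "convex {v. p v < P}"
  proof (rule convexI)
    fix x y :: "real \<times> real" and u v :: real
    assume as: "x \<in> {v. p v < P}" "y \<in> {v. p v < P}" "0 \<le> u" "0 \<le> v" "u + v = 1"
    have "p (u *\<^sub>R x + v *\<^sub>R y) \<le> u * p x + v * p y"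
      using p_triangle[of "u *\<^sub>R x" "v *\<^sub>R y"] as by (simp add: p_scaleR)
    also have "\<dots> < P" using as by (intro convex_bound_lt) auto
    finally show "u *\<^sub>R x + v *\<^sub>R y \<in> {v. p v < P}" by simp
  qed
  have "p 0 = 0" by (simp add: p_eq_0_iff)
  with P have "{v. p v < P} \<noteq> {}" by (metis (mono_tags) empty_iff mem_Collect_eq)
  moreover have "{v. p v < P} \<inter> {(r, s)} = {}" by (auto simp: P_def)
  ultimately obtain n c where n: "n \<noteq> 0" "\<And>v. p v < P \<Longrightarrow> n \<bullet> v \<le> c" "c \<le> n \<bullet> (r, s)"
    using separating_hyperplane_sets[OF cx convex_singleton[of "(r, s)"]]
    by (metis insert_not_empty mem_Collect_eq singletonI)
  \<comment> \<open>The separation only controls vectors of norm less than \<open>P\<close>, so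
    \<open>v\<close> is rescaled to norm \<open>x\<close> below \<open>P\<close>, and
    \<open>x\<close> tends to \<open>P\<close>.\<close>
  have bound: "n \<bullet> v * P \<le> c * p v" for v
  proof (cases "v = 0")
    case True
    then show ?thesis using \<open>p 0 = 0\<close> by simp
  next
    case False
    then have pv: "p v > 0" using p_nonneg[of v] p_eq_0_iff[of v] by simp
    have "n \<bullet> v * x \<le> c * p v" if x: "0 < x" "x < P" for x
    proof -
      have "p ((x / p v) *\<^sub>R v) < P" using x pv by (simp add: p_scaleR)
      from n(2)[OF this] show ?thesis using pv by (simp add: field_simps)
    qed
    then have "\<forall>\<^sub>F x in at_left P. n \<bullet> v * x \<le> c * p v"
      using eventually_at_left_real[OF P] by (rule eventually_mono[rotated]) auto
    moreover have "((\<lambda>x. n \<bullet> v * x) \<longlongrightarrow> n \<bullet> v * P) (at_left P)" by (intro tendsto_intros)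
    ultimately show ?thesis by (intro tendsto_upperbound[of _ _ "at_left P"]) auto
  qed
  have "n \<bullet> n > 0" using n(1) by simp
  then have "0 < c * p n" using bound[of n] P by (smt (verit) mult_pos_pos)
  then have c: "c > 0" using p_nonneg[of n] by (simp add: zero_less_mult_iff)
  define a b where "a = \<bar>fst n\<bar> * P / c" and "b = \<bar>snd n\<bar> * P / c"
  have le: "a * r' + b * s' \<le> p (r', s')" for r' s'
  proof -
    \<comment> \<open>Giving the coordinates the signs of \<open>n\<close> turns the inner product
      with \<open>n\<close> into a sum of absolute values. A vanishing coordinate of
      \<open>n\<close> has sign 0, so below \<open>p\<close> is compared by monotonicity and not by
      equality.\<close>
    define r2 s2 where "r2 = sgn (fst n) * \<bar>r'\<bar>" and "s2 = sgn (snd n) * \<bar>s'\<bar>"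
    have "a * r' + b * s' \<le> a * \<bar>r'\<bar> + b * \<bar>s'\<bar>"
      using P c by (intro add_mono mult_left_mono) (auto simp: a_def b_def)
    also have "\<dots> = n \<bullet> (r2, s2) * P / c"
      by (cases n) (simp add: a_def b_def r2_def s2_def abs_sgn algebra_simps add_divide_distrib)
    also have "\<dots> \<le> p (r2, s2)" using bound[of "(r2, s2)"] c by (simp add: field_simps)
    also have "\<dots> \<le> p (\<bar>r'\<bar>, \<bar>s'\<bar>)"
      by (intro p_mono) (auto simp: r2_def s2_def abs_mult sgn_if)
    finally show ?thesis by (simp add: p_abs)
  qed
  have "P * c \<le> (n \<bullet> (r, s)) * P" using n(3) P by (simp add: mult.commute)
  also have "\<dots> \<le> (\<bar>fst n\<bar> * r + \<bar>snd n\<bar> * s) * P"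
    using P assms by (cases n) (auto intro!: mult_right_mono add_mono)
  finally have "P \<le> a * r + b * s" using c by (simp add: a_def b_def field_simps)
  with le[of r s] have "a * r + b * s = p (r, s)" by (simp add: P_def)
  moreover have "(a, b) \<in> dual_ball" using le P c by (auto simp: dual_ball_def a_def b_def)
  ultimately show ?thesis by (intro bexI[of _ "(a, b)"]) auto
qed

text \<open>For \<open>c\<close> in the dual ball this is the nonnegative part of the face of the
  unit ball exposed by \<open>c\<close>; it is empty if \<open>c\<close> has dual norm below
  1.\<close>

definition face :: "real \<times> real \<Rightarrow> (real \<times> real) set" where
  "face c = {(r, s) \<in> positive_ball. fst c * r + snd c * s = 1}"

lemma face_norm:
  assumes "c \<in> dual_ball" and "(r, s) \<in> face c"
  shows "p (r, s) = 1"
proof (rule antisym)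
  show "p (r, s) \<le> 1" using assms(2) by (simp add: face_def positive_ball_def)
  have "fst c * r + snd c * s \<le> p (r, s)" using assms(1) by (simp add: dual_ball_def case_prod_beta)
  then show "1 \<le> p (r, s)" using assms(2) by (simp add: face_def)
qed

text \<open>By compactness, \<open>c\<close> stays below 1 by a fixed margin on the part of the
  positive ball at distance at least \<open>e\<close> from the face. A small perturbation
  \<open>d\<close> of \<open>c\<close> preserves this.\<close>

lemma slice_near_face_local:
  assumes c: "c \<in> dual_ball" and e: "e > 0"
  shows "\<exists>\<delta>>0. \<forall>d\<in>ball c \<delta>.
    (fst c = 0 \<or> \<delta> \<le> fst d) \<and> (snd c = 0 \<or> \<delta> \<le> snd d) \<and>
    (\<forall>v\<in>positive_ball. fst d * fst v + snd d * snd v > 1 - \<delta> \<longrightarrow> (\<exists>w\<in>face c. dist v w < e))"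
proof -
  define K where "K = positive_ball - (\<Union>w\<in>face c. ball w e)"
  have K: "compact K" unfolding K_def by (intro compact_diff compact_positive_ball) auto
  have "\<exists>\<gamma>>0. \<forall>v\<in>K. fst c * fst v + snd c * snd v \<le> 1 - \<gamma>"
  proof (cases "K = {}")
    case False
    obtain v where v: "v \<in> K"
      and max: "\<And>w. w \<in> K \<Longrightarrow> fst c * fst w + snd c * snd w \<le> fst c * fst v + snd c * snd v"
    proof -
      have "continuous_on K (\<lambda>v. fst c * fst v + snd c * snd v)" by (intro continuous_intros)
      from continuous_attains_sup[OF K False this] show ?thesis using that by blast
    qed
    have "fst c * fst v + snd c * snd v \<le> p v" "p v \<le> 1"
      using v c by (auto simp: K_def dual_ball_def positive_ball_def)
    moreover have "fst c * fst v + snd c * snd v \<noteq> 1"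
      using v e by (force simp: K_def face_def)
    ultimately show ?thesis
      using max by (intro exI[of _ "1 - (fst c * fst v + snd c * snd v)"]) auto
  qed (auto intro: exI[of _ 1])
  then obtain \<gamma> where \<gamma>: "\<gamma> > 0" "\<And>v. v \<in> K \<Longrightarrow> fst c * fst v + snd c * snd v \<le> 1 - \<gamma>"
    by blast
  \<comment> \<open>The margin \<gamma> pays for the depth of the slice and for the perturbation of
    each of the two coefficients. The halves keep a positive coefficient of \<open>c\<close> at
    least \<delta> after the perturbation; a zero coefficient imposes no constraint, hence the
    1.\<close>
  define \<delta> where "\<delta> = min (\<gamma> / 3)
    (min (if fst c = 0 then 1 else fst c / 2) (if snd c = 0 then 1 else snd c / 2))"
  have c0: "0 \<le> fst c" "0 \<le> snd c" using c by (auto simp: dual_ball_def)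
  have \<delta>: "\<delta> > 0" "\<delta> \<le> \<gamma> / 3" "fst c \<noteq> 0 \<Longrightarrow> \<delta> \<le> fst c / 2" "snd c \<noteq> 0 \<Longrightarrow> \<delta> \<le> snd c / 2"
    using \<gamma>(1) c0 by (simp_all add: \<delta>_def)
  show ?thesis
  proof (intro exI[of _ \<delta>] conjI ballI impI \<delta>(1))
    fix d assume "d \<in> ball c \<delta>"
    then have d: "\<bar>fst c - fst d\<bar> < \<delta>" "\<bar>snd c - snd d\<bar> < \<delta>"
      using dist_fst_le[of c d] dist_snd_le[of c d] by (auto simp: dist_real_def)
    show "fst c = 0 \<or> \<delta> \<le> fst d" "snd c = 0 \<or> \<delta> \<le> snd d" using d \<delta>(3,4) by linarith+
    fix v assume v: "v \<in> positive_ball" "1 - \<delta> < fst d * fst v + snd d * snd v"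
    have v1: "0 \<le> fst v" "fst v \<le> 1" "0 \<le> snd v" "snd v \<le> 1"
      using v(1) p_ge_abs(1)[of "fst v" "snd v"] p_ge_abs(2)[of "snd v" "fst v"]
      by (auto simp: positive_ball_def)
    have "(fst d - fst c) * fst v \<le> \<delta> * 1" "(snd d - snd c) * snd v \<le> \<delta> * 1"
      using d v1 \<delta>(1) by (intro mult_mono; simp)+
    then have "fst c * fst v + snd c * snd v > 1 - \<gamma>"
      using v(2) \<delta>(2) by (simp add: algebra_simps)
    then have "v \<notin> K" using \<gamma>(2)[of v] by linarith
    then show "\<exists>w\<in>face c. dist v w < e" using v(1) by (auto simp: K_def dist_commute)
  qed
qed

text \<open>For a single functional every slice is close to a face, but the bound
  depends on the functional. Replacing the functional by a nearby one makes it uniform, by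
  compactness, and avoids positive coefficients that are arbitrarily small.\<close>

lemma slice_near_face:
  assumes e: "e > 0"
  obtains \<delta> where "\<delta> > 0"
    and "\<And>d. d \<in> dual_ball \<Longrightarrow> \<exists>c\<in>dual_ball.
      (fst c = 0 \<or> \<delta> \<le> fst d) \<and> (snd c = 0 \<or> \<delta> \<le> snd d) \<and>
      (\<forall>v\<in>positive_ball. fst d * fst v + snd d * snd v > 1 - \<delta> \<longrightarrow> (\<exists>w\<in>face c. dist v w < e))"
proof -
  from slice_near_face_local[OF _ e] obtain \<Delta> where \<Delta>: "\<And>c. c \<in> dual_ball \<Longrightarrow> \<Delta> c > 0"
    "\<And>c d. c \<in> dual_ball \<Longrightarrow> d \<in> ball c (\<Delta> c) \<Longrightarrow>
      (fst c = 0 \<or> \<Delta> c \<le> fst d) \<and> (snd c = 0 \<or> \<Delta> c \<le> snd d) \<and>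
      (\<forall>v\<in>positive_ball. fst d * fst v + snd d * snd v > 1 - \<Delta> c \<longrightarrow> (\<exists>w\<in>face c. dist v w < e))"
    by metis
  obtain C where C: "C \<subseteq> dual_ball" "finite C" "dual_ball \<subseteq> (\<Union>c\<in>C. ball c (\<Delta> c))"
    using compactE_image[OF compact_dual_ball, of dual_ball "\<lambda>c. ball c (\<Delta> c)"] \<Delta>(1) by force
  \<comment> \<open>The least of the bounds that belong to a finite subcover; the added 1 makes the
    set visibly nonempty.\<close>
  define \<delta> where "\<delta> = Min (insert 1 (\<Delta> ` C))"
  have \<delta>: "\<delta> > 0" "\<And>c. c \<in> C \<Longrightarrow> \<delta> \<le> \<Delta> c"
    using C \<Delta>(1) by (auto simp: \<delta>_def)
  show thesis
  proof (rule that[OF \<delta>(1)])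
    fix d assume "d \<in> dual_ball"
    then obtain c where c: "c \<in> C" "d \<in> ball c (\<Delta> c)" using C(3) by blast
    then have cd: "c \<in> dual_ball" using C(1) by blast
    show "\<exists>c\<in>dual_ball. (fst c = 0 \<or> \<delta> \<le> fst d) \<and> (snd c = 0 \<or> \<delta> \<le> snd d) \<and>
      (\<forall>v\<in>positive_ball. fst d * fst v + snd d * snd v > 1 - \<delta> \<longrightarrow> (\<exists>w\<in>face c. dist v w < e))"
      using \<Delta>(2)[OF cd c(2)] \<delta>(2)[OF c(1)]
      by (intro bexI[OF _ cd]) (meson diff_left_mono le_less_trans order_trans)
  qed
qed

end


section \<open>Functionals and the AHSp\<close>

lemma exists_phase: "\<exists>c::'k::real_normed_field. norm c = 1 \<and> c * w = of_real (norm w)"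
proof (cases "w = 0")
  case False
  then show ?thesis
    by (intro exI[of _ "of_real (norm w) / w"]) (simp add: norm_divide)
qed (auto intro: exI[of _ 1])

text \<open>Equality in the triangle inequality for \<open>w\<close> and \<open>1 - w\<close> puts
  \<open>w\<close> on the segment from 0 to 1. In the complex case the real parts already use up the
  total length 1, so the imaginary part vanishes.\<close>

lemma real_or_complex_nonneg:
  fixes w :: "'k::real_or_complex"
  assumes "norm w + norm (1 - w) \<le> 1"
  shows "w = of_real (norm w)"
proof -
  consider "\<forall>z::'k. \<exists>a. z = a *\<^sub>R 1"
    | i :: 'k where "\<forall>z::'k. \<exists>a b. z = a *\<^sub>R 1 + b *\<^sub>R i"
        "\<forall>a b. norm (a *\<^sub>R 1 + b *\<^sub>R i) = sqrt (a\<^sup>2 + b\<^sup>2)"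
    using real_or_complex by blast
  then show ?thesis
  proof cases
    case 1
    then obtain a where w: "w = of_real a" by (metis of_real_def)
    then have "1 - w = of_real (1 - a)" by simp
    then have "norm w = \<bar>a\<bar>" "norm (1 - w) = \<bar>1 - a\<bar>"
      unfolding w by (simp_all only: norm_of_real)
    then show ?thesis using assms w by simp
  next
    case 2
    then obtain a b where w: "w = a *\<^sub>R 1 + b *\<^sub>R i" by blast
    have "1 - w = (1 - a) *\<^sub>R 1 + (- b) *\<^sub>R i" by (simp add: w algebra_simps)
    then have "norm w = sqrt (a\<^sup>2 + b\<^sup>2)" "norm (1 - w) = sqrt ((1 - a)\<^sup>2 + (- b)\<^sup>2)"
      using 2(2) w by metis+
    moreover have "sqrt ((1 - a)\<^sup>2 + (- b)\<^sup>2) \<ge> \<bar>1 - a\<bar>" "sqrt (a\<^sup>2 + b\<^sup>2) \<ge> \<bar>a\<bar>"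
      by (rule real_le_rsqrt; simp)+
    ultimately have na: "norm w = a" "sqrt (a\<^sup>2 + b\<^sup>2) = a" using assms by linarith+
    then have "a\<^sup>2 + b\<^sup>2 = a\<^sup>2" using real_sqrt_pow2[of "a\<^sup>2 + b\<^sup>2"] by simp
    then have "b = 0" by simp
    then show ?thesis using w na by (simp add: of_real_def)
  qed
qed

lemma AHSp_for_mono:
  assumes "AHSp_for smul Y \<epsilon> \<eta>" and le: "\<eta>' \<le> \<eta>"
  shows "AHSp_for smul Y \<epsilon> \<eta>'"
  unfolding AHSp_for_def
proof (intro allI impI)
  fix x \<alpha>
  assume *: "\<forall>n. x n \<in> Y \<inter> sphere 0 1" "convex_series \<alpha>" "1 - \<eta>' < norm (\<Sum>n. \<alpha> n *\<^sub>R x n)"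
  then have "1 - \<eta> < norm (\<Sum>n. \<alpha> n *\<^sub>R x n)" using le by linarith
  with * show "\<exists>A z. (\<forall>k\<in>A. z k \<in> Y \<inter> sphere 0 1) \<and> (\<Sum>\<^sub>\<infinity>k\<in>A. \<alpha> k) > 1 - \<epsilon> \<and>
      (\<forall>k\<in>A. norm (z k - x k) < \<epsilon>) \<and> (\<exists>f\<in>dual_unit_sphere smul Y. \<forall>k\<in>A. f (z k) = 1)"
    by (intro assms(1)[unfolded AHSp_for_def, THEN spec, THEN spec, THEN mp, THEN mp, THEN mp])
qed

text \<open>Lowering \<eta> only strengthens the hypothesis on the series, so the pointwise minimum
  of two functions serves both subspaces.\<close>

lemma AHSp_common_function:
  assumes "AHSp smul M" and "AHSp smul N"
  shows "\<exists>\<eta>. AHSp_with smul M \<eta> \<and> AHSp_with smul N \<eta>"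
proof -
  obtain \<eta>1 where 1: "\<And>\<epsilon>. 0 < \<epsilon> \<and> \<epsilon> < 1 \<Longrightarrow> 0 < \<eta>1 \<epsilon> \<and> \<eta>1 \<epsilon> < \<epsilon> \<and> AHSp_for smul M \<epsilon> (\<eta>1 \<epsilon>)"
    using assms(1) unfolding AHSp_def by metis
  obtain \<eta>2 where 2: "\<And>\<epsilon>. 0 < \<epsilon> \<and> \<epsilon> < 1 \<Longrightarrow> 0 < \<eta>2 \<epsilon> \<and> \<eta>2 \<epsilon> < \<epsilon> \<and> AHSp_for smul N \<epsilon> (\<eta>2 \<epsilon>)"
    using assms(2) unfolding AHSp_def by metis
  have "AHSp_with smul M (\<lambda>\<epsilon>. min (\<eta>1 \<epsilon>) (\<eta>2 \<epsilon>)) \<and> AHSp_with smul N (\<lambda>\<epsilon>. min (\<eta>1 \<epsilon>) (\<eta>2 \<epsilon>))"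
    unfolding AHSp_with_def
    using 1 2 by (auto intro: AHSp_for_mono[OF _ min.cobounded1] AHSp_for_mono[OF _ min.cobounded2]
        simp: min_less_iff_disj)
  then show ?thesis by blast
qed

section \<open>Functionals of norm one on a subspace\<close>

context banach_space_over
begin

lemma subspace_scaleR: "subspace Y \<Longrightarrow> x \<in> Y \<Longrightarrow> r *\<^sub>R x \<in> Y"
  using subspace_scale[of Y x "of_real r"] by (simp add: smul_of_real)

lemma functional_scaleR:
  assumes "bounded_functional_on smul Y f" and "x \<in> Y"
  shows "f (r *\<^sub>R x) = of_real r * f x"
  using assms unfolding bounded_functional_on_def by (metis smul_of_real)

lemma dual_unit_sphere_bound:
  assumes Y: "subspace Y" and f: "f \<in> dual_unit_sphere smul Y" and x: "x \<in> Y"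
  shows "norm (f x) \<le> norm x"
proof (cases "x = 0")
  case True
  have "f (0 *\<^sub>R x) = of_real 0 * f x"
    using f x by (intro functional_scaleR) (auto simp: dual_unit_sphere_def)
  then show ?thesis using True by simp
next
  case False
  have bf: "bounded_functional_on smul Y f" and dn: "dual_norm_on Y f = 1"
    using f by (simp_all add: dual_unit_sphere_def)
  obtain K where K: "\<And>y. y \<in> Y \<Longrightarrow> norm (f y) \<le> K * norm y"
    using bf unfolding bounded_functional_on_def by blast
  have "norm (f y) \<le> \<bar>K\<bar>" if "y \<in> Y" "norm y \<le> 1" for y
  proof -
    have "K * norm y \<le> \<bar>K\<bar> * 1" using that by (intro mult_mono) auto
    with K[OF that(1)] show ?thesis by simp
  qed
  \<comment> \<open>Only for a set that is bounded above does the supremum in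
    \<open>dual_norm_on\<close> bound the individual values.\<close>
  then have bdd: "bdd_above ((\<lambda>x. norm (f x)) ` {x \<in> Y. norm x \<le> 1})"
    by (intro bdd_aboveI2[where M = "\<bar>K\<bar>"]) auto
  have "norm (f ((1 / norm x) *\<^sub>R x)) \<le> dual_norm_on Y f"
    unfolding dual_norm_on_def using False x Y
    by (intro cSUP_upper[OF _ bdd]) (auto intro: subspace_scaleR)
  then show ?thesis
    using False unfolding dn functional_scaleR[OF bf x] norm_mult norm_of_real
    by (simp add: field_simps)
qed

text \<open>The value 1 at the unit vector \<open>z\<close> makes the supremum a maximum equal to
  1.\<close>

lemma dual_unit_sphereI:
  assumes "\<And>x y. x \<in> Y \<Longrightarrow> y \<in> Y \<Longrightarrow> f (x + y) = f x + f y"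
    and "\<And>c x. x \<in> Y \<Longrightarrow> f (smul c x) = c * f x"
    and bound: "\<And>x. x \<in> Y \<Longrightarrow> norm (f x) \<le> norm x"
    and z: "z \<in> Y" "norm z = 1" "f z = 1"
  shows "f \<in> dual_unit_sphere smul Y"
proof -
  have "bounded_functional_on smul Y f"
    unfolding bounded_functional_on_def using assms(1,2) bound
    by (auto intro!: exI[of _ 1])
  moreover have "dual_norm_on Y f = 1"
    unfolding dual_norm_on_def
    using bound z by (intro cSup_eq_maximum) (force intro: image_eqI[of _ _ z] order_trans)+
  ultimately show ?thesis by (simp add: dual_unit_sphere_def)
qed

text \<open>Reweighting the normalized vectors by their norms turns the additive defect
  \<open>(\<Sum>n. \<alpha> n * norm (x n)) - norm (\<Sum>n. \<alpha> n *\<^sub>R x n)\<close> into the hypothesis of the AHSp;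
  no Hahn--Banach functional is needed. Short vectors are close to any short multiple of a
  unit vector, so they can be added to the index set for free.\<close>

lemma AHSp_aligned:
  assumes AHSp: "AHSp smul Y" and y0: "y0 \<in> Y" "norm y0 = 1" and Y: "subspace Y"
    and e: "0 < e" "e < 1"
  obtains \<delta> where "\<delta> > 0"
    and "\<And>\<alpha> x. convex_series \<alpha> \<Longrightarrow> (\<And>n. x n \<in> Y) \<Longrightarrow> (\<And>n. norm (x n) \<le> 1) \<Longrightarrow>
      (\<Sum>n. \<alpha> n * norm (x n)) - norm (\<Sum>n. \<alpha> n *\<^sub>R x n) < \<delta> \<Longrightarrow>
      \<exists>f\<in>dual_unit_sphere smul Y. \<exists>A u. (\<forall>k. u k \<in> Y \<and> norm (u k) = 1 \<and> f (u k) = 1) \<and>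
        infsum \<alpha> A > 1 - e \<and> (\<forall>k\<in>A. norm (norm (x k) *\<^sub>R u k - x k) < e)"
proof -
  \<comment> \<open>Returning from the new weights to \<alpha> outside the short vectors costs the
    factor \<open>2 / e\<close>, and so does Markov's inequality at the threshold
    \<open>e / 2\<close>; with this choice \<open>2 / e * e'\<close> is
    \<open>e / 2\<close>.\<close>
  define e' where "e' = e\<^sup>2 / 4"
  have "e\<^sup>2 < e" using e by (simp add: power2_eq_square)
  then have e': "0 < e'" "e' < e" "e' < 1" using e by (auto simp: e'_def)
  then obtain \<eta> where \<eta>: "0 < \<eta>" "\<eta> < e'" "AHSp_for smul Y e' \<eta>"
    using AHSp unfolding AHSp_def by blast
  have sphere: "\<exists>f\<in>dual_unit_sphere smul Y. \<exists>A z. infsum \<beta> A > 1 - e' \<and> A \<noteq> {} \<and>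
      (\<forall>k\<in>A. z k \<in> Y \<and> norm (z k) = 1 \<and> f (z k) = 1 \<and> norm (z k - y k) < e')"
    if "convex_series \<beta>" "\<And>n. y n \<in> Y" "\<And>n. norm (y n) = 1" "norm (\<Sum>n. \<beta> n *\<^sub>R y n) > 1 - \<eta>"
    for \<beta> y
  proof -
    have "\<forall>n. y n \<in> Y \<inter> sphere 0 1" using that by simp
    from \<eta>(3)[unfolded AHSp_for_def, THEN spec, THEN spec, THEN mp, OF this, THEN mp, OF that(1),
      THEN mp, OF that(4)]
    obtain A z f where *: "\<forall>k\<in>A. z k \<in> Y \<inter> sphere 0 1"
      "(\<Sum>\<^sub>\<infinity>k\<in>A. \<beta> k) > 1 - e'" "\<forall>k\<in>A. norm (z k - y k) < e'"
      "f \<in> dual_unit_sphere smul Y" "\<forall>k\<in>A. f (z k) = 1"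
      by blast
    have "A \<noteq> {}" using *(2) e'(3) by auto
    with * show ?thesis by (intro bexI[of _ f] exI[of _ A] exI[of _ z]) auto
  qed
  show thesis
  \<comment> \<open>A defect below this, divided by a mean norm of at least \<open>e'\<close>, is
    below \<eta>.\<close>
  proof (rule that[of "\<eta> * e'"])
    show "0 < \<eta> * e'" using \<eta> e' by simp
    fix \<alpha> and x :: "nat \<Rightarrow> 'a"
    assume \<alpha>: "convex_series \<alpha>" and xY: "\<And>n. x n \<in> Y" and x1: "\<And>n. norm (x n) \<le> 1"
      and defect: "(\<Sum>n. \<alpha> n * norm (x n)) - norm (\<Sum>n. \<alpha> n *\<^sub>R x n) < \<eta> * e'"
    define \<Lambda> where "\<Lambda> = (\<Sum>n. \<alpha> n * norm (x n))"
    have \<alpha>01: "0 \<le> \<alpha> n" "\<alpha> n \<le> 1" for n using \<alpha> by (auto simp: convex_series_def)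
    have summ: "summable (\<lambda>n. \<alpha> n * norm (x n))"
      using convex_series_summable_scaleR[OF \<alpha>, of "\<lambda>n. norm (x n)" 1] x1 by simp
    have "\<Lambda> \<le> suminf \<alpha>"
      unfolding \<Lambda>_def using \<alpha> x1 summ
      by (intro suminf_le) (auto simp: convex_series_def mult_left_le intro: sums_summable)
    then have \<Lambda>1: "\<Lambda> \<le> 1" using \<alpha> by (simp add: convex_series_def sums_iff)
    have short: "norm (norm (x k) *\<^sub>R w - x k) < e" if "norm w = 1" "norm (x k) < e / 2" for k w
      using norm_triangle_ineq4[of "norm (x k) *\<^sub>R w" "x k"] that by simp
    show "\<exists>f\<in>dual_unit_sphere smul Y. \<exists>A u. (\<forall>k. u k \<in> Y \<and> norm (u k) = 1 \<and> f (u k) = 1) \<and>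
        infsum \<alpha> A > 1 - e \<and> (\<forall>k\<in>A. norm (norm (x k) *\<^sub>R u k - x k) < e)"
    proof (cases "\<Lambda> < e'")
      case True
      \<comment> \<open>When the mean norm is small, Markov's inequality makes most vectors short,
        and any direction will do. The constant sequence \<open>y0\<close> serves only to obtain a
        norm-attaining functional from the AHSp.\<close>
      have "(\<lambda>n. \<alpha> n *\<^sub>R y0) sums (1 *\<^sub>R y0)"
        using \<alpha> unfolding convex_series_def by (intro sums_scaleR_left) auto
      then have "norm (\<Sum>n. \<alpha> n *\<^sub>R y0) > 1 - \<eta>" using y0 \<eta> by (simp add: sums_iff)
      from sphere[OF \<alpha>, of "\<lambda>_. y0", OF y0 this] obtain f w where
        w: "f \<in> dual_unit_sphere smul Y" "w \<in> Y" "norm w = 1" "f w = 1" by blast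
      have "infsum \<alpha> {n. e / 2 \<le> norm (x n)} \<le> \<Lambda> / (e / 2)"
        unfolding \<Lambda>_def using summ e by (intro convex_series_markov \<alpha>) auto
      also have "\<dots> < e' / (e / 2)" using True e by (simp add: divide_strict_right_mono)
      also have "\<dots> \<le> e" using e by (simp add: e'_def power2_eq_square)
      finally have "infsum \<alpha> (- {n. e / 2 \<le> norm (x n)}) > 1 - e"
        by (simp add: convex_series_infsum_Compl[OF \<alpha>])
      then show ?thesis
        using w short[OF w(3)]
        by (intro bexI[OF _ w(1)] exI[of _ "- {n. e / 2 \<le> norm (x n)}"] exI[of _ "\<lambda>_. w"]) auto
    next
      case False
      then have \<Lambda>: "e' \<le> \<Lambda>" "\<Lambda> > 0" using e' by auto
      define \<beta> where "\<beta> n = \<alpha> n * norm (x n) / \<Lambda>" for n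
      \<comment> \<open>Zero vectors have weight zero in \<beta>, so their direction is
        arbitrary.\<close>
      define y where "y n = (if x n = 0 then y0 else (1 / norm (x n)) *\<^sub>R x n)" for n
      have y: "y n \<in> Y" "norm (y n) = 1" "norm (x n) *\<^sub>R y n = x n" for n
        using y0 xY Y by (auto simp: y_def intro: subspace_scaleR)
      have \<beta>sums: "\<beta> sums 1"
        using sums_divide[OF summable_sums[OF summ], of \<Lambda>] \<Lambda> by (simp add: \<beta>_def[abs_def] flip: \<Lambda>_def)
      have \<beta>0: "0 \<le> \<beta> n" for n using \<alpha>01 \<Lambda> by (simp add: \<beta>_def)
      have "\<beta> n \<le> 1" for n
        using sum_le_suminf[of \<beta> "{n}"] \<beta>sums \<beta>0 by (auto simp: sums_iff)
      with \<beta>sums \<beta>0 have \<beta>: "convex_series \<beta>" by (simp add: convex_series_def)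
      have "\<beta> n *\<^sub>R y n = (1 / \<Lambda>) *\<^sub>R (\<alpha> n *\<^sub>R x n)" for n
      proof -
        have "\<beta> n *\<^sub>R y n = (\<alpha> n / \<Lambda>) *\<^sub>R (norm (x n) *\<^sub>R y n)" by (simp add: \<beta>_def)
        then show ?thesis unfolding y(3) by simp
      qed
      then have "(\<Sum>n. \<beta> n *\<^sub>R y n) = (1 / \<Lambda>) *\<^sub>R (\<Sum>n. \<alpha> n *\<^sub>R x n)"
        using suminf_scaleR_right[OF convex_series_summable_scaleR[where x = x, OF \<alpha> x1], of "1 / \<Lambda>"]
        by simp
      then have "norm (\<Sum>n. \<beta> n *\<^sub>R y n) = norm (\<Sum>n. \<alpha> n *\<^sub>R x n) / \<Lambda>"
        using \<Lambda> by simp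
      also have "\<dots> > (\<Lambda> - \<eta> * \<Lambda>) / \<Lambda>"
      proof (intro divide_strict_right_mono)
        have "\<eta> * e' \<le> \<eta> * \<Lambda>" using \<Lambda> \<eta> by (intro mult_left_mono) auto
        then show "\<Lambda> - \<eta> * \<Lambda> < norm (\<Sum>n. \<alpha> n *\<^sub>R x n)" using defect by (simp add: \<Lambda>_def)
      qed (use \<Lambda> in simp)
      also have "(\<Lambda> - \<eta> * \<Lambda>) / \<Lambda> = 1 - \<eta>" using \<Lambda> by (simp add: field_simps)
      finally obtain f A z k0 where f: "f \<in> dual_unit_sphere smul Y"
        and A: "infsum \<beta> A > 1 - e'" "k0 \<in> A"
        and z: "\<And>k. k \<in> A \<Longrightarrow> z k \<in> Y \<and> norm (z k) = 1 \<and> f (z k) = 1 \<and> norm (z k - y k) < e'"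
        using sphere[OF \<beta>, of y, OF y(1,2)] by blast
      define B where "B = {k. norm (x k) < e / 2} \<union> A"
      \<comment> \<open>Indices outside \<open>A\<close> receive the fixed direction
        \<open>z k0\<close>; those among them that lie in \<open>B\<close> have short
        \<open>x k\<close>.\<close>
      define u where "u k = (if k \<in> A then z k else z k0)" for k
      have u: "u k \<in> Y \<and> norm (u k) = 1 \<and> f (u k) = 1" for k using z A(2) by (simp add: u_def)
      \<comment> \<open>Outside \<open>B\<close> the vectors are long and \<Lambda> is at most 1, so
        \<alpha> is at most \<open>2 / e\<close> times \<beta>, which has little weight outside
        \<open>A\<close>.\<close>
      have "infsum \<alpha> (- B) \<le> infsum (\<lambda>n. 2 / e * \<beta> n) (- A)"
      proof (rule infsum_mono_neutral)
        fix n assume "n \<in> - B \<inter> - A"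
        then have "e / 2 \<le> norm (x n)" by (simp add: B_def)
        then have "\<alpha> n * (e / 2) \<le> \<alpha> n * norm (x n)" using \<alpha>01 by (intro mult_left_mono) auto
        also have "\<dots> = \<beta> n * \<Lambda>" using \<Lambda> by (simp add: \<beta>_def)
        also have "\<dots> \<le> \<beta> n" using \<Lambda>1 \<beta>0 by (simp add: mult_left_le)
        finally show "\<alpha> n \<le> 2 / e * \<beta> n" using e by (simp add: field_simps)
      next
        show "(\<lambda>n. 2 / e * \<beta> n) summable_on - A"
          by (intro summable_on_cmult_right convex_series_summable_on \<beta>)
      qed (use e \<beta>0 \<alpha> in \<open>auto simp: B_def intro: convex_series_summable_on\<close>)
      also have "\<dots> = 2 / e * infsum \<beta> (- A)"
        by (intro infsum_cmult_right convex_series_summable_on \<beta>)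
      also have "\<dots> \<le> 2 / e * e'"
        using A(1) e by (intro mult_left_mono) (auto simp: convex_series_infsum_Compl[OF \<beta>])
      also have "\<dots> < e" using e by (simp add: e'_def power2_eq_square)
      finally have "infsum \<alpha> B > 1 - e" by (simp add: convex_series_infsum_Compl[OF \<alpha>])
      moreover have "norm (norm (x k) *\<^sub>R u k - x k) < e" if "k \<in> B" for k
      proof (cases "k \<in> A")
        case True
        have "norm (norm (x k) *\<^sub>R u k - x k) = norm (norm (x k) *\<^sub>R (z k - y k))"
          using True y(3)[of k] by (simp add: u_def scaleR_diff_right)
        also have "\<dots> \<le> 1 * norm (z k - y k)" using x1 by (simp add: mult_left_le_one_le)
        also have "\<dots> < e" using z[OF True] e' by simp
        finally show ?thesis .
      qed (use that short u in \<open>auto simp: B_def\<close>)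
      ultimately show ?thesis using u by (intro bexI[OF _ f] exI[of _ B] exI[of _ u]) auto
    qed
  qed
qed

end


section \<open>Absolute sums\<close>

locale absolute_sum = banach_space_over smul + absolute_normalized p
  for smul :: "'k::real_or_complex \<Rightarrow> 'a::banach \<Rightarrow> 'a" and p :: "real \<times> real \<Rightarrow> real" +
  fixes M N :: "'a set"
  assumes decomposition: "direct_sum_decomposition smul M N"
    and norm_sum: "\<And>m n. m \<in> M \<Longrightarrow> n \<in> N \<Longrightarrow> norm (m + n) = p (norm m, norm n)"
begin

section \<open>The two projections of the decomposition\<close>

lemma subspaces: "subspace M" "subspace N"
  using decomposition by (auto simp: direct_sum_decomposition_def)

definition proj1 :: "'a \<Rightarrow> 'a" where "proj1 x = (SOME m. m \<in> M \<and> x - m \<in> N)"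

definition proj2 :: "'a \<Rightarrow> 'a" where "proj2 x = x - proj1 x"

lemma proj_in: "proj1 x \<in> M" "proj2 x \<in> N"
proof -
  have "x \<in> {m + n | m n. m \<in> M \<and> n \<in> N}"
    using decomposition by (simp add: direct_sum_decomposition_def)
  then have "\<exists>m. m \<in> M \<and> x - m \<in> N" by auto
  from someI_ex[OF this] show "proj1 x \<in> M" "proj2 x \<in> N"
    by (simp_all add: proj1_def proj2_def)
qed

lemma proj_sum: "proj1 x + proj2 x = x"
  by (simp add: proj2_def)

text \<open>Two decompositions of a vector differ by an element of \<open>M \<inter> N\<close>,
  which is zero; hence the choice in \<open>proj1\<close> is unique.\<close>

lemma proj_eqI:
  assumes "m \<in> M" and "n \<in> N"
  shows "proj1 (m + n) = m" "proj2 (m + n) = n"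
proof -
  have eq: "proj1 (m + n) - m = n - proj2 (m + n)" by (simp add: proj2_def)
  have "proj1 (m + n) - m \<in> M" using assms proj_in subspaces by (blast intro: subspace_diff)
  moreover have "proj1 (m + n) - m \<in> N"
    unfolding eq using assms proj_in subspaces by (blast intro: subspace_diff)
  ultimately have "proj1 (m + n) - m \<in> M \<inter> N" by (rule IntI)
  moreover have "M \<inter> N = {0}" using decomposition by (simp add: direct_sum_decomposition_def)
  ultimately have "proj1 (m + n) - m = 0" by (simp only: singleton_iff)
  then show "proj1 (m + n) = m" "proj2 (m + n) = n" using eq by simp_all
qed

lemma proj_add: "proj1 (x + y) = proj1 x + proj1 y" "proj2 (x + y) = proj2 x + proj2 y"
proof -
  have "x + y = (proj1 x + proj1 y) + (proj2 x + proj2 y)" by (simp add: proj2_def)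
  moreover have "proj1 x + proj1 y \<in> M" "proj2 x + proj2 y \<in> N"
    using proj_in subspaces by (blast intro: subspace_add)+
  ultimately show "proj1 (x + y) = proj1 x + proj1 y" "proj2 (x + y) = proj2 x + proj2 y"
    using proj_eqI by metis+
qed

lemma proj_smul: "proj1 (smul c x) = smul c (proj1 x)" "proj2 (smul c x) = smul c (proj2 x)"
proof -
  have "smul c x = smul c (proj1 x) + smul c (proj2 x)"
    unfolding scale_right_distrib[symmetric] proj_sum ..
  moreover have "smul c (proj1 x) \<in> M" "smul c (proj2 x) \<in> N"
    using proj_in subspaces by (blast intro: subspace_scale)+
  ultimately show "proj1 (smul c x) = smul c (proj1 x)" "proj2 (smul c x) = smul c (proj2 x)"
    using proj_eqI by metis+
qed

lemma norm_eq_p: "norm x = p (norm (proj1 x), norm (proj2 x))"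
  using norm_sum[OF proj_in, of x x] by (simp add: proj_sum)

lemma norm_proj_le: "norm (proj1 x) \<le> norm x" "norm (proj2 x) \<le> norm x"
  unfolding norm_eq_p[of x] 
  using p_ge_abs(1)[of "norm (proj1 x)" "norm (proj2 x)"] p_ge_abs(2)[of "norm (proj2 x)" "norm (proj1 x)"]
  by simp_all

text \<open>Continuity, which comes from \<open>p\<close> dominating both coordinates, carries the
  projections through infinite series.\<close>

lemma bounded_linear_proj: "bounded_linear proj1" "bounded_linear proj2"
proof -
  have "proj1 (r *\<^sub>R x) = r *\<^sub>R proj1 x" "proj2 (r *\<^sub>R x) = r *\<^sub>R proj2 x" for r x
    using proj_smul[of "of_real r" x] by (simp_all add: smul_of_real)
  then show "bounded_linear proj1" "bounded_linear proj2"
    using norm_proj_le by (auto intro!: bounded_linear_intro[where K = 1] proj_add)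
qed

lemma norm_diff_le:
  assumes "m \<in> M" and "n \<in> N"
  shows "norm ((m + n) - x) \<le> norm (m - proj1 x) + norm (n - proj2 x)"
proof -
  have "(m + n) - x = (m - proj1 x) + (n - proj2 x)" using proj_sum[of x] by (simp add: algebra_simps)
  then show ?thesis by (metis norm_triangle_ineq)
qed

lemma UNIV_eq_if_trivial: "M = {0} \<Longrightarrow> N = UNIV"
  using decomposition by (auto simp: direct_sum_decomposition_def)

text \<open>A functional norming \<open>m + n\<close> splits the norm optimally between the two components.
  Hence its restriction to \<open>M\<close>, once normalized, norms every \<open>m / norm m\<close>; the
  normalizing constant cannot depend on \<open>m\<close> because each value is the norm of the restriction.\<close>

lemma functional_restricts:
  assumes f: "f \<in> dual_unit_sphere smul UNIV"
    and z: "\<And>k. k \<in> A \<Longrightarrow> norm (z k) = 1 \<and> f (z k) = 1 \<and> norm (proj2 (z k)) < 1"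
    and A: "A \<noteq> {}"
  shows "\<exists>g\<in>dual_unit_sphere smul M. \<forall>k\<in>A. proj1 (z k) \<noteq> 0 \<and>
    g ((1 / norm (proj1 (z k))) *\<^sub>R proj1 (z k)) = 1"
proof -
  have bf: "bounded_functional_on smul UNIV f" using f by (simp add: dual_unit_sphere_def)
  have f_add: "f (x + y) = f x + f y" and f_smul: "f (smul c x) = c * f x" for x y c
    using bf by (auto simp: bounded_functional_on_def)
  have f_le: "norm (f x) \<le> norm x" for x
    using dual_unit_sphere_bound[OF subspace_UNIV f] by simp
  \<comment> \<open>The first component is replaced by a multiple of \<open>m\<close> that is no
    longer, and unimodular factors make both values of \<open>f\<close> nonnegative. By monotonicity
    of \<open>p\<close> the new vector still has norm at most 1.\<close>
  have split: "norm (proj1 (z k)) * norm (f m) + norm (f (proj2 (z k))) \<le> 1"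
    if k: "k \<in> A" and m: "m \<in> M" "norm m \<le> 1" for k m
  proof -
    obtain c where c: "norm c = 1" "c * f m = of_real (norm (f m))" using exists_phase by blast
    obtain d where d: "norm d = 1" "d * f (proj2 (z k)) = of_real (norm (f (proj2 (z k))))"
      using exists_phase by blast
    define x where "x = smul (of_real (norm (proj1 (z k))) * c) m"
    define y where "y = smul d (proj2 (z k))"
    have "f (x + y) = of_real (norm (proj1 (z k)) * norm (f m) + norm (f (proj2 (z k))))"
      using c(2) d(2) by (simp add: x_def y_def f_add f_smul mult.assoc)
    then have "norm (proj1 (z k)) * norm (f m) + norm (f (proj2 (z k))) = norm (f (x + y))"
      by (simp only: norm_of_real) simp
    also have "\<dots> \<le> norm (x + y)" by (rule f_le)
    also have "\<dots> = p (norm x, norm y)"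
      using m proj_in subspaces by (intro norm_sum) (auto simp: x_def y_def intro: subspace_scale)
    also have "\<dots> \<le> p (norm (proj1 (z k)), norm (proj2 (z k)))"
      using c d m by (intro p_mono) (auto simp: x_def y_def norm_smul norm_mult mult_left_le)
    also have "\<dots> = 1" using norm_eq_p[of "z k"] z[OF k] by simp
    finally show ?thesis .
  qed
  have key: "proj1 (z k) \<noteq> 0 \<and> norm (f (proj1 (z k))) > 0 \<and>
      f (proj1 (z k)) = of_real (norm (f (proj1 (z k)))) \<and>
      (\<forall>m\<in>M. norm (proj1 (z k)) * norm (f m) \<le> norm (f (proj1 (z k))) * norm m)"
    if k: "k \<in> A" for k
  proof -
    have sum: "f (proj1 (z k)) + f (proj2 (z k)) = 1"
      unfolding f_add[symmetric] proj_sum using z[OF k] by simp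
    \<comment> \<open>The second component is too short to carry the value 1, so \<open>f\<close>
      cannot vanish at the first.\<close>
    have "norm (f (proj2 (z k))) < 1" using f_le[of "proj2 (z k)"] z[OF k] by linarith
    then have pos: "norm (f (proj1 (z k))) > 0"
      using sum by (auto simp: zero_less_norm_iff)
    then have nz: "proj1 (z k) \<noteq> 0" using f_le[of "proj1 (z k)"] by auto
    have le1: "norm (f (proj1 (z k))) + norm (f (proj2 (z k))) \<le> 1"
    proof -
      have "norm (f ((1 / norm (proj1 (z k))) *\<^sub>R proj1 (z k))) = norm (f (proj1 (z k))) / norm (proj1 (z k))"
        unfolding functional_scaleR[OF bf UNIV_I] norm_mult norm_of_real by simp
      moreover have "norm (proj1 (z k)) * norm (f ((1 / norm (proj1 (z k))) *\<^sub>R proj1 (z k)))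
          + norm (f (proj2 (z k))) \<le> 1"
        using nz proj_in subspaces by (intro split[OF k]) (auto intro: subspace_scaleR)
      ultimately show ?thesis using nz by simp
    qed
    \<comment> \<open>Rewritten by this equation, \<open>le1\<close> is the hypothesis of
      \<open>real_or_complex_nonneg\<close> for the value at the first component.\<close>
    have proj2_eq: "f (proj2 (z k)) = 1 - f (proj1 (z k))" using sum by (simp add: algebra_simps)
    have ge1: "1 \<le> norm (f (proj1 (z k))) + norm (f (proj2 (z k)))"
      using norm_triangle_ineq[of "f (proj1 (z k))" "f (proj2 (z k))"] sum by simp
    have "norm (proj1 (z k)) * norm (f m) \<le> norm (f (proj1 (z k))) * norm m" if m: "m \<in> M" for m
    proof (cases "m = 0")
      case True
      then show ?thesis using f_le[of m] by simp
    next
      case False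
      have "norm (f ((1 / norm m) *\<^sub>R m)) = norm (f m) / norm m"
        unfolding functional_scaleR[OF bf UNIV_I] norm_mult norm_of_real by simp
      moreover have "norm (proj1 (z k)) * norm (f ((1 / norm m) *\<^sub>R m)) + norm (f (proj2 (z k))) \<le> 1"
        using False m subspaces by (intro split[OF k]) (auto intro: subspace_scaleR)
      ultimately have "norm (proj1 (z k)) * (norm (f m) / norm m) \<le> norm (f (proj1 (z k)))"
        using ge1 by simp
      then show ?thesis using False by (simp add: field_simps)
    qed
    moreover have "f (proj1 (z k)) = of_real (norm (f (proj1 (z k))))"
      using le1 unfolding proj2_eq by (rule real_or_complex_nonneg)
    ultimately show ?thesis using pos nz by blast
  qed
  obtain j where j: "j \<in> A" using A by blast
  \<comment> \<open>By \<open>key\<close>, this quotient is the norm of the restriction of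
    \<open>f\<close> to \<open>M\<close>.\<close>
  define D where "D = norm (f (proj1 (z j))) / norm (proj1 (z j))"
  define g where "g x = f x / of_real D" for x
  have D: "D > 0" using key[OF j] by (simp add: D_def)
  have g_at: "g ((1 / norm (proj1 (z k))) *\<^sub>R proj1 (z k)) = 1" if k: "k \<in> A" for k
  proof -
    \<comment> \<open>Testing \<open>key\<close> at each of the two indices with the component of
      the other gives equal quotients, so \<open>D\<close> serves every \<open>k\<close>.\<close>
    have "norm (proj1 (z k)) * norm (f (proj1 (z j))) \<le> norm (f (proj1 (z k))) * norm (proj1 (z j))"
      "norm (proj1 (z j)) * norm (f (proj1 (z k))) \<le> norm (f (proj1 (z j))) * norm (proj1 (z k))"
      using key[OF k] key[OF j] proj_in by blast+
    then have "norm (f (proj1 (z k))) = D * norm (proj1 (z k))"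
      using key[OF j] by (simp add: D_def field_simps)
    then have "f (proj1 (z k)) = of_real (D * norm (proj1 (z k)))" using key[OF k] by metis
    then show ?thesis
      unfolding g_def functional_scaleR[OF bf UNIV_I] using D key[OF k] by simp
  qed
  have "g \<in> dual_unit_sphere smul M"
  proof (rule dual_unit_sphereI)
    show "g (x + y) = g x + g y" for x y by (simp add: g_def f_add add_divide_distrib)
    show "g (smul c x) = c * g x" for c x by (simp add: g_def f_smul)
    show "norm (g x) \<le> norm x" if "x \<in> M" for x
    proof -
      have "norm (proj1 (z j)) * norm (f x) \<le> norm (f (proj1 (z j))) * norm x"
        using key[OF j] that by blast
      then have "norm (f x) \<le> D * norm x" using key[OF j] by (simp add: D_def field_simps)
      then show ?thesis using D by (simp add: g_def norm_divide field_simps)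
    qed
    show "(1 / norm (proj1 (z j))) *\<^sub>R proj1 (z j) \<in> M"
      using proj_in subspaces by (blast intro: subspace_scaleR)
    show "norm ((1 / norm (proj1 (z j))) *\<^sub>R proj1 (z j)) = 1" using key[OF j] by simp
  qed (rule g_at[OF j])
  with g_at key show ?thesis by blast
qed

text \<open>A sequence in \<open>M\<close> is approximated in the sum by points whose components in
  \<open>N\<close> are small. The components in \<open>M\<close> lie within
  \<open>\<epsilon> / 2\<close> of the sequence, and normalizing them moves them by less than
  another \<open>\<epsilon> / 2\<close>.\<close>

lemma AHSp_summand:
  assumes "AHSp smul UNIV"
  shows "AHSp smul M"
  unfolding AHSp_def
proof (intro allI impI)
  fix \<epsilon> :: real assume \<epsilon>: "0 < \<epsilon> \<and> \<epsilon> < 1"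
  then obtain \<eta> where \<eta>: "0 < \<eta>" "\<eta> < \<epsilon> / 2" "AHSp_for smul UNIV (\<epsilon> / 2) \<eta>"
    using assms[unfolded AHSp_def, rule_format, of "\<epsilon> / 2"] by auto
  have "AHSp_for smul M \<epsilon> \<eta>" unfolding AHSp_for_def
  proof (intro allI impI)
    fix x \<alpha>
    assume x: "\<forall>n. x n \<in> M \<inter> sphere 0 1" and \<alpha>: "convex_series \<alpha>"
      and big: "1 - \<eta> < norm (\<Sum>n. \<alpha> n *\<^sub>R x n)"
    have "\<forall>n. x n \<in> UNIV \<inter> sphere 0 1" using x by blast
    from \<eta>(3)[unfolded AHSp_for_def, THEN spec, THEN spec, THEN mp, OF this, THEN mp, OF \<alpha>,
      THEN mp, OF big]
    obtain A z f where z: "\<forall>k\<in>A. z k \<in> UNIV \<inter> sphere 0 1"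
      and A: "(\<Sum>\<^sub>\<infinity>k\<in>A. \<alpha> k) > 1 - \<epsilon> / 2" and near: "\<forall>k\<in>A. norm (z k - x k) < \<epsilon> / 2"
      and f: "f \<in> dual_unit_sphere smul UNIV" "\<forall>k\<in>A. f (z k) = 1"
      by blast
    have "A \<noteq> {}" using A \<epsilon> by auto
    have px: "proj1 (x k) = x k" "proj2 (x k) = 0" "norm (x k) = 1" for k
      using proj_eqI[of "x k" 0] x subspaces by (auto simp: subspace_0)
    have "proj1 (z k - x k) = proj1 (z k) - x k" "proj2 (z k - x k) = proj2 (z k)" for k
      using px by (simp_all add: bounded_linear_proj[THEN bounded_linear.linear, THEN linear_diff])
    then have near': "norm (proj1 (z k) - x k) < \<epsilon> / 2" "norm (proj2 (z k)) < \<epsilon> / 2" if "k \<in> A" for k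
      using norm_proj_le[of "z k - x k"] near that by force+
    have zk: "norm (z k) = 1 \<and> f (z k) = 1 \<and> norm (proj2 (z k)) < 1" if "k \<in> A" for k
      using near'(2)[OF that] z f(2) \<epsilon> that by auto
    from functional_restricts[OF f(1), of A z, OF zk \<open>A \<noteq> {}\<close>] obtain g where
      g: "g \<in> dual_unit_sphere smul M" and g1: "\<And>k. k \<in> A \<Longrightarrow> proj1 (z k) \<noteq> 0 \<and>
        g ((1 / norm (proj1 (z k))) *\<^sub>R proj1 (z k)) = 1"
      by blast
    define u where "u k = (1 / norm (proj1 (z k))) *\<^sub>R proj1 (z k)" for k
    have u: "u k \<in> M \<inter> sphere 0 1" if "k \<in> A" for k
      using g1[OF that] proj_in subspaces by (auto simp: u_def intro: subspace_scaleR)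
    have "norm (u k - x k) < \<epsilon>" if k: "k \<in> A" for k
    proof -
      \<comment> \<open>Normalizing moves a vector by the deviation of its norm from 1, which its
        distance to the unit vector \<open>x k\<close> bounds.\<close>
      have "u k - proj1 (z k) = (1 - norm (proj1 (z k))) *\<^sub>R u k"
        using g1[OF k] by (simp only: scaleR_diff_left) (simp add: u_def)
      then have "norm (u k - proj1 (z k)) = \<bar>norm (x k) - norm (proj1 (z k))\<bar>"
        using u[OF k] px by simp
      also have "\<dots> \<le> norm (proj1 (z k) - x k)" by (metis norm_minus_commute norm_triangle_ineq3)
      finally have "norm (u k - proj1 (z k)) < \<epsilon> / 2" using near'(1)[OF k] by linarith
      then show ?thesis
        using near'(1)[OF k] norm_triangle_ineq[of "u k - proj1 (z k)" "proj1 (z k) - x k"] by simp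
    qed
    then show "\<exists>A z. (\<forall>k\<in>A. z k \<in> M \<inter> sphere 0 1) \<and> (\<Sum>\<^sub>\<infinity>k\<in>A. \<alpha> k) > 1 - \<epsilon> \<and>
        (\<forall>k\<in>A. norm (z k - x k) < \<epsilon>) \<and> (\<exists>f\<in>dual_unit_sphere smul M. \<forall>k\<in>A. f (z k) = 1)"
      using u A \<epsilon> g g1 by (intro exI[of _ A] exI[of _ u]) (auto simp: u_def)
  qed
  then show "\<exists>\<eta>>0. \<eta> < \<epsilon> \<and> AHSp_for smul M \<epsilon> \<eta>" using \<eta> \<epsilon> by (intro exI[of _ \<eta>]) auto
qed

text \<open>If the coefficient of a component in the supporting functional of the face vanishes, its
  alignment gives no information and is not needed.\<close>

lemma aligned_or_vanishing:
  fixes a :: real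
  assumes Y: "subspace Y" "y0 \<in> Y" "norm y0 = 1"
    and al: "a = 0 \<or> (\<exists>f\<in>dual_unit_sphere smul Y. \<exists>A u.
        (\<forall>k. u k \<in> Y \<and> norm (u k) = 1 \<and> f (u k) = 1) \<and>
        infsum \<alpha> A > 1 - e \<and> (\<forall>k\<in>A. norm (norm (x k) *\<^sub>R u k - x k) < e))"
    and \<alpha>: "convex_series \<alpha>" and e: "e > 0" and xY: "\<And>k. x k \<in> Y"
  obtains f A u where "\<And>v w. v \<in> Y \<Longrightarrow> w \<in> Y \<Longrightarrow> f (v + w) = f v + f w"
    and "\<And>c v. v \<in> Y \<Longrightarrow> f (smul c v) = c * f v" and "\<And>v. v \<in> Y \<Longrightarrow> norm (f v) \<le> norm v"
    and "\<And>k::nat. u k \<in> Y \<and> norm (u k) = 1 \<and> of_real a * f (u k) = of_real a"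
    and "infsum \<alpha> A > 1 - e" and "\<And>k. k \<in> A \<Longrightarrow> norm (norm (x k) *\<^sub>R u k - x k) < e"
proof (cases "a = 0")
  case True
  define u where "u k = (if x k = 0 then y0 else (1 / norm (x k)) *\<^sub>R x k)" for k
  show thesis
  \<comment> \<open>The zero functional is admissible because its values at \<open>u k\<close> are
    only prescribed after multiplication by \<open>a\<close>. As \<open>u\<close> follows
    \<open>x\<close> exactly, no index is lost.\<close>
  proof (rule that[of "\<lambda>_. 0" u UNIV])
    show "u k \<in> Y \<and> norm (u k) = 1 \<and> of_real a * 0 = of_real a" for k
      using Y xY True by (auto simp: u_def intro: subspace_scaleR)
    show "infsum \<alpha> UNIV > 1 - e" using convex_series_infsum_UNIV[OF \<alpha>] e by simp
    show "norm (norm (x k) *\<^sub>R u k - x k) < e" for k using e by (simp add: u_def)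
  qed auto
next
  case False
  then obtain f A u where f: "f \<in> dual_unit_sphere smul Y"
    and u: "\<And>k. u k \<in> Y \<and> norm (u k) = 1 \<and> f (u k) = 1" and A: "infsum \<alpha> A > 1 - e"
    and near: "\<And>k. k \<in> A \<Longrightarrow> norm (norm (x k) *\<^sub>R u k - x k) < e"
    using al by blast
  show thesis
  proof (rule that[of f u A])
    show "norm (f v) \<le> norm v" if "v \<in> Y" for v by (rule dual_unit_sphere_bound[OF Y(1) f that])
  qed (use f u A near in \<open>auto simp: dual_unit_sphere_def bounded_functional_on_def\<close>)
qed

lemma AHSp_sum_nontrivial:
  assumes AM: "AHSp smul M" and AN: "AHSp smul N"
    and m0: "m0 \<in> M" "norm m0 = 1" and n0: "n0 \<in> N" "norm n0 = 1"
  shows "AHSp smul UNIV"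
  unfolding AHSp_def
proof (intro allI impI)
  fix \<epsilon> :: real assume \<epsilon>: "0 < \<epsilon> \<and> \<epsilon> < 1"
  \<comment> \<open>Three exceptional sets cost weight \<open>3 * e\<close>, and the final distance
    is below \<open>4 * e\<close>: each of the two components contributes \<open>e\<close> for its
    length and \<open>e\<close> for its direction.\<close>
  define e where "e = \<epsilon> / 4"
  have e: "0 < e" "e < 1" using \<epsilon> by (auto simp: e_def)
  obtain \<delta>M where \<delta>M: "\<delta>M > 0" "\<And>\<alpha> x. convex_series \<alpha> \<Longrightarrow> (\<And>n. x n \<in> M) \<Longrightarrow> (\<And>n. norm (x n) \<le> 1) \<Longrightarrow>
      (\<Sum>n. \<alpha> n * norm (x n)) - norm (\<Sum>n. \<alpha> n *\<^sub>R x n) < \<delta>M \<Longrightarrow>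
      \<exists>f\<in>dual_unit_sphere smul M. \<exists>A u. (\<forall>k. u k \<in> M \<and> norm (u k) = 1 \<and> f (u k) = 1) \<and>
        infsum \<alpha> A > 1 - e \<and> (\<forall>k\<in>A. norm (norm (x k) *\<^sub>R u k - x k) < e)"
    by (rule AHSp_aligned[OF AM m0 subspaces(1) e]) blast
  obtain \<delta>N where \<delta>N: "\<delta>N > 0" "\<And>\<alpha> x. convex_series \<alpha> \<Longrightarrow> (\<And>n. x n \<in> N) \<Longrightarrow> (\<And>n. norm (x n) \<le> 1) \<Longrightarrow>
      (\<Sum>n. \<alpha> n * norm (x n)) - norm (\<Sum>n. \<alpha> n *\<^sub>R x n) < \<delta>N \<Longrightarrow>
      \<exists>f\<in>dual_unit_sphere smul N. \<exists>A u. (\<forall>k. u k \<in> N \<and> norm (u k) = 1 \<and> f (u k) = 1) \<and>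
        infsum \<alpha> A > 1 - e \<and> (\<forall>k\<in>A. norm (norm (x k) *\<^sub>R u k - x k) < e)"
    by (rule AHSp_aligned[OF AN n0 subspaces(2) e]) blast
  obtain \<delta> where \<delta>: "\<delta> > 0" "\<And>d. d \<in> dual_ball \<Longrightarrow> \<exists>c\<in>dual_ball.
      (fst c = 0 \<or> \<delta> \<le> fst d) \<and> (snd c = 0 \<or> \<delta> \<le> snd d) \<and>
      (\<forall>v\<in>positive_ball. fst d * fst v + snd d * snd v > 1 - \<delta> \<longrightarrow> (\<exists>w\<in>face c. dist v w < e))"
    by (rule slice_near_face[OF e(1)]) blast
  \<comment> \<open>The bound \<open>\<delta> * e\<close> is for Markov's inequality at the
    threshold \<delta>; the last two allow division of a weighted defect by a coefficient of at
    least \<delta>.\<close>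
  define \<eta> where "\<eta> = min e (min (\<delta> * e) (min (\<delta> * \<delta>M) (\<delta> * \<delta>N)))"
  have \<eta>: "\<eta> > 0" "\<eta> \<le> e" "\<eta> \<le> \<delta> * e" "\<eta> \<le> \<delta> * \<delta>M" "\<eta> \<le> \<delta> * \<delta>N"
    using e \<delta>(1) \<delta>M(1) \<delta>N(1) by (simp_all add: \<eta>_def)
  have "AHSp_for smul UNIV \<epsilon> \<eta>" unfolding AHSp_for_def
  proof (intro allI impI)
    fix x :: "nat \<Rightarrow> 'a" and \<alpha>
    assume "\<forall>n. x n \<in> UNIV \<inter> sphere 0 1" and \<alpha>: "convex_series \<alpha>"
      and big: "1 - \<eta> < norm (\<Sum>n. \<alpha> n *\<^sub>R x n)"
    then have x1: "norm (x n) = 1" for n by simp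
    define s where "s = (\<Sum>n. \<alpha> n *\<^sub>R x n)"
    define \<mu> \<nu> where "\<mu> n = norm (proj1 (x n))" and "\<nu> n = norm (proj2 (x n))" for n
    have p1: "p (\<mu> n, \<nu> n) = 1" for n using norm_eq_p[of "x n"] x1 by (simp add: \<mu>_def \<nu>_def)
    have \<mu>1: "\<mu> n \<le> 1" and \<nu>1: "\<nu> n \<le> 1" for n
      using norm_proj_le[of "x n"] x1 by (simp_all add: \<mu>_def \<nu>_def)
    have \<alpha>0: "0 \<le> \<alpha> n" for n using \<alpha> by (simp add: convex_series_def)
    have s1: "proj1 s = (\<Sum>n. \<alpha> n *\<^sub>R proj1 (x n))" and s2: "proj2 s = (\<Sum>n. \<alpha> n *\<^sub>R proj2 (x n))"
      using bounded_linear.suminf[OF bounded_linear_proj(1) convex_series_summable_scaleR[OF \<alpha>, of x 1]]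
        bounded_linear.suminf[OF bounded_linear_proj(2) convex_series_summable_scaleR[OF \<alpha>, of x 1]] x1
      by (simp_all add: s_def bounded_linear_proj[THEN bounded_linear.linear, THEN linear_scale])
    obtain d where d: "d \<in> dual_ball"
      "fst d * norm (proj1 s) + snd d * norm (proj2 s) = p (norm (proj1 s), norm (proj2 s))"
      using dual_ball_norming[of "norm (proj1 s)" "norm (proj2 s)"] by auto
    have d0: "0 \<le> fst d" "0 \<le> snd d" using d(1) by (auto simp: dual_ball_def)
    have d_le: "fst d * \<mu> n + snd d * \<nu> n \<le> 1" for n
      using d(1) p1[of n] by (auto simp: dual_ball_def case_prod_beta) (metis)
    have sbig: "fst d * norm (proj1 s) + snd d * norm (proj2 s) > 1 - \<eta>"
      using big norm_eq_p[of s] d(2) by (simp add: s_def)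
    have sum\<mu>: "summable (\<lambda>n. \<alpha> n * \<mu> n)" and sum\<nu>: "summable (\<lambda>n. \<alpha> n * \<nu> n)"
      using convex_series_summable_scaleR[OF \<alpha>, of \<mu> 1] convex_series_summable_scaleR[OF \<alpha>, of \<nu> 1]
        \<mu>1 \<nu>1 by (simp_all add: \<mu>_def \<nu>_def)
    define S1 S2 where "S1 = (\<Sum>n. \<alpha> n * \<mu> n)" and "S2 = (\<Sum>n. \<alpha> n * \<nu> n)"
    have S: "norm (proj1 s) \<le> S1" "norm (proj2 s) \<le> S2"
      using convex_series_norm_suminf_le[OF \<alpha>, of "\<lambda>n. proj1 (x n)" 1]
        convex_series_norm_suminf_le[OF \<alpha>, of "\<lambda>n. proj2 (x n)" 1] \<mu>1 \<nu>1
      by (simp_all add: S1_def S2_def \<mu>_def \<nu>_def s1 s2)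
    \<comment> \<open>The amount by which \<open>d\<close> misses 1 at the pair of norms of
      \<open>x n\<close>. It is nonnegative and its mean is below \<eta>, so it is below \<delta> at
      most indices.\<close>
    define h where "h n = 1 - (fst d * \<mu> n + snd d * \<nu> n)" for n
    have h0: "0 \<le> h n" for n using d_le[of n] by (simp add: h_def)
    have "(\<lambda>n. \<alpha> n - (fst d * (\<alpha> n * \<mu> n) + snd d * (\<alpha> n * \<nu> n))) sums (1 - (fst d * S1 + snd d * S2))"
      unfolding S1_def S2_def using \<alpha> sum\<mu> sum\<nu>
      by (intro sums_diff sums_add sums_mult summable_sums) (auto simp: convex_series_def)
    then have hs: "(\<lambda>n. \<alpha> n * h n) sums (1 - (fst d * S1 + snd d * S2))"
      by (simp add: h_def algebra_simps)
    have dS: "fst d * norm (proj1 s) \<le> fst d * S1" "snd d * norm (proj2 s) \<le> snd d * S2"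
      using S d0 by (auto intro: mult_left_mono)
    have hsum_nonneg: "0 \<le> (\<Sum>n. \<alpha> n * h n)"
      using hs h0 \<alpha>0 by (intro suminf_nonneg) (auto simp: sums_iff)
    have dS1: "fst d * S1 + snd d * S2 \<le> 1" using hs hsum_nonneg by (simp add: sums_iff)
    \<comment> \<open>From here on \<open>c\<close> supplies the face, while \<open>d\<close> still
      measures the slice. Where a coefficient of \<open>c\<close> is nonzero, that of
      \<open>d\<close> is at least \<delta>.\<close>
    obtain c where c: "c \<in> dual_ball" and c1: "fst c = 0 \<or> \<delta> \<le> fst d" and c2: "snd c = 0 \<or> \<delta> \<le> snd d"
      and c_near: "\<And>v. v \<in> positive_ball \<Longrightarrow> fst d * fst v + snd d * snd v > 1 - \<delta> \<Longrightarrow>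
        \<exists>w\<in>face c. dist v w < e"
      using \<delta>(2)[OF d(1)] by blast
    have c0: "0 \<le> fst c" "0 \<le> snd c" using c by (auto simp: dual_ball_def)

    define A0 where "A0 = - {n. \<delta> \<le> h n}"
    have "infsum \<alpha> {n. \<delta> \<le> h n} \<le> (\<Sum>n. \<alpha> n * h n) / \<delta>"
      using hs by (intro convex_series_markov \<alpha> h0 \<delta>(1)) (auto simp: sums_iff)
    also have "\<dots> < \<eta> / \<delta>"
      using hs sbig dS \<delta>(1) by (intro divide_strict_right_mono) (auto simp: sums_iff)
    also have "\<dots> \<le> e" using \<eta>(3) \<delta>(1) by (simp add: field_simps)
    finally have A0: "infsum \<alpha> A0 > 1 - e" by (simp add: A0_def convex_series_infsum_Compl[OF \<alpha>])
    have "\<exists>w\<in>face c. dist (\<mu> n, \<nu> n) w < e" if "n \<in> A0" for n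
      using that p1[of n] by (intro c_near) (auto simp: A0_def h_def positive_ball_def \<mu>_def \<nu>_def)
    then have "\<forall>n. \<exists>w. n \<in> A0 \<longrightarrow> w \<in> face c \<and> dist (\<mu> n, \<nu> n) w < e" by blast
    then obtain w where w: "\<And>n. n \<in> A0 \<Longrightarrow> w n \<in> face c \<and> dist (\<mu> n, \<nu> n) (w n) < e" by metis

    have defect: "a * (S - t) < \<eta> \<Longrightarrow> \<delta> \<le> a \<Longrightarrow> t \<le> S \<Longrightarrow> \<eta> \<le> \<delta> * r \<Longrightarrow> S - t < r" for a S t r :: real
    proof -
      assume *: "a * (S - t) < \<eta>" "\<delta> \<le> a" "t \<le> S" "\<eta> \<le> \<delta> * r"
      have "\<delta> * (S - t) \<le> a * (S - t)" using * by (intro mult_right_mono) auto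
      then have "\<delta> * (S - t) < \<delta> * r" using * by linarith
      then show "S - t < r" using \<delta>(1) by simp
    qed
    \<comment> \<open>The two weighted defects are nonnegative and add up to less than \<eta>, so
      each of them is less than \<eta>.\<close>
    have gap: "fst d * (S1 - norm (proj1 s)) < \<eta>" "snd d * (S2 - norm (proj2 s)) < \<eta>"
      unfolding right_diff_distrib using sbig dS dS1 by linarith+
    have "fst c = 0 \<or> S1 - norm (proj1 s) < \<delta>M"
      using c1 defect[OF gap(1) _ S(1) \<eta>(4)] by blast
    then have "fst c = 0 \<or> (\<exists>f\<in>dual_unit_sphere smul M. \<exists>A u.
        (\<forall>k. u k \<in> M \<and> norm (u k) = 1 \<and> f (u k) = 1) \<and>
        infsum \<alpha> A > 1 - e \<and> (\<forall>k\<in>A. norm (norm (proj1 (x k)) *\<^sub>R u k - proj1 (x k)) < e))"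
      using \<delta>M(2)[OF \<alpha>, of "\<lambda>n. proj1 (x n)"] proj_in \<mu>1 by (auto simp: S1_def \<mu>_def s1)
    then obtain f A1 u where f: "\<And>v w. v \<in> M \<Longrightarrow> w \<in> M \<Longrightarrow> f (v + w) = f v + f w"
      "\<And>c v. v \<in> M \<Longrightarrow> f (smul c v) = c * f v" "\<And>v. v \<in> M \<Longrightarrow> norm (f v) \<le> norm v"
      and u: "\<And>k. u k \<in> M \<and> norm (u k) = 1 \<and> of_real (fst c) * f (u k) = of_real (fst c)"
      and A1: "infsum \<alpha> A1 > 1 - e" "\<And>k. k \<in> A1 \<Longrightarrow> norm (\<mu> k *\<^sub>R u k - proj1 (x k)) < e"
      unfolding \<mu>_def
      by (rule aligned_or_vanishing[OF subspaces(1) m0 _ \<alpha> e(1) proj_in(1)]) blast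
    have "snd c = 0 \<or> S2 - norm (proj2 s) < \<delta>N"
      using c2 defect[OF gap(2) _ S(2) \<eta>(5)] by blast
    then have "snd c = 0 \<or> (\<exists>f\<in>dual_unit_sphere smul N. \<exists>A u.
        (\<forall>k. u k \<in> N \<and> norm (u k) = 1 \<and> f (u k) = 1) \<and>
        infsum \<alpha> A > 1 - e \<and> (\<forall>k\<in>A. norm (norm (proj2 (x k)) *\<^sub>R u k - proj2 (x k)) < e))"
      using \<delta>N(2)[OF \<alpha>, of "\<lambda>n. proj2 (x n)"] proj_in \<nu>1 by (auto simp: S2_def \<nu>_def s2)
    then obtain g A2 v where g: "\<And>v w. v \<in> N \<Longrightarrow> w \<in> N \<Longrightarrow> g (v + w) = g v + g w"
      "\<And>c v. v \<in> N \<Longrightarrow> g (smul c v) = c * g v" "\<And>v. v \<in> N \<Longrightarrow> norm (g v) \<le> norm v"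
      and v: "\<And>k. v k \<in> N \<and> norm (v k) = 1 \<and> of_real (snd c) * g (v k) = of_real (snd c)"
      and A2: "infsum \<alpha> A2 > 1 - e" "\<And>k. k \<in> A2 \<Longrightarrow> norm (\<nu> k *\<^sub>R v k - proj2 (x k)) < e"
      unfolding \<nu>_def
      by (rule aligned_or_vanishing[OF subspaces(2) n0 _ \<alpha> e(1) proj_in(2)]) blast

    define A where "A = A0 \<inter> (A1 \<inter> A2)"
    \<comment> \<open>The point \<open>w k\<close> of the face supplies the lengths,
      \<open>u k\<close> and \<open>v k\<close> the directions.\<close>
    define m n where "m k = fst (w k) *\<^sub>R u k" and "n k = snd (w k) *\<^sub>R v k" for k
    \<comment> \<open>Membership of \<open>c\<close> in the dual ball will bound \<open>F\<close> by
      the norm; the pairs of lengths on the face of \<open>c\<close> make it attain 1.\<close>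
    define F where "F y = of_real (fst c) * f (proj1 y) + of_real (snd c) * g (proj2 y)" for y
    have "infsum \<alpha> A > 1 - 3 * e"
      using convex_series_infsum_Int_ge[OF \<alpha>, of A0 "A1 \<inter> A2"]
        convex_series_infsum_Int_ge[OF \<alpha>, of A1 A2] A0 A1(1) A2(1)
      by (simp add: A_def)
    then have A: "infsum \<alpha> A > 1 - \<epsilon>" using e by (simp add: e_def)
    then have "A \<noteq> {}" using \<epsilon> by auto
    have mn: "m k \<in> M" "n k \<in> N" for k
      using u v subspaces by (auto simp: m_def n_def intro: subspace_scaleR)
    have z: "norm (m k + n k) = 1" "F (m k + n k) = 1" "norm ((m k + n k) - x k) < \<epsilon>" if "k \<in> A" for k
    proof -
      have wk: "w k \<in> face c" "dist (\<mu> k, \<nu> k) (w k) < e" using w that by (auto simp: A_def)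
      then have w0: "0 \<le> fst (w k)" "0 \<le> snd (w k)" by (auto simp: face_def positive_ball_def)
      have "norm (m k + n k) = p (fst (w k), snd (w k))"
        using norm_sum[OF mn, of k k] u v w0 by (simp add: m_def n_def)
      also have "\<dots> = 1" using wk c by (intro face_norm[of c]) auto
      finally show "norm (m k + n k) = 1" .
      have "F (m k + n k) = of_real (fst (w k)) * (of_real (fst c) * f (u k))
          + of_real (snd (w k)) * (of_real (snd c) * g (v k))"
        \<comment> \<open>Homogeneity of \<open>f\<close> and \<open>g\<close> is available for
          \<open>smul\<close>, so real multiples are first written through it.\<close>
        unfolding F_def proj_eqI[OF mn] unfolding m_def n_def smul_of_real[symmetric]
        using f(2) g(2) u v by (simp add: algebra_simps)
      also have "\<dots> = of_real (fst c * fst (w k) + snd c * snd (w k))"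
        using u[of k] v[of k] by (simp only: of_real_add of_real_mult mult.commute)
      also have "\<dots> = 1" using wk(1) by (simp add: face_def case_prod_beta)
      finally show "F (m k + n k) = 1" .
      have near: "\<bar>fst (w k) - \<mu> k\<bar> < e" "\<bar>snd (w k) - \<nu> k\<bar> < e"
        using wk(2) dist_fst_le[of "(\<mu> k, \<nu> k)" "w k"] dist_snd_le[of "(\<mu> k, \<nu> k)" "w k"]
        by (auto simp: dist_real_def)
      have "norm (m k - \<mu> k *\<^sub>R u k) < e" "norm (n k - \<nu> k *\<^sub>R v k) < e"
        using near u v by (simp_all add: m_def n_def flip: scaleR_diff_left)
      moreover have "norm (\<mu> k *\<^sub>R u k - proj1 (x k)) < e" "norm (\<nu> k *\<^sub>R v k - proj2 (x k)) < e"
        using A1(2) A2(2) that by (auto simp: A_def)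
      moreover have "norm (m k - proj1 (x k)) \<le> norm (m k - \<mu> k *\<^sub>R u k) + norm (\<mu> k *\<^sub>R u k - proj1 (x k))"
        "norm (n k - proj2 (x k)) \<le> norm (n k - \<nu> k *\<^sub>R v k) + norm (\<nu> k *\<^sub>R v k - proj2 (x k))"
        using dist_triangle[of "m k" "proj1 (x k)" "\<mu> k *\<^sub>R u k"]
          dist_triangle[of "n k" "proj2 (x k)" "\<nu> k *\<^sub>R v k"]
        by (simp_all add: dist_norm)
      ultimately show "norm ((m k + n k) - x k) < \<epsilon>"
        using norm_diff_le[OF mn, of k k "x k"] by (simp add: e_def)
    qed
    have "F \<in> dual_unit_sphere smul UNIV"
    proof -
      obtain j where j: "j \<in> A" using \<open>A \<noteq> {}\<close> by blast
      show ?thesis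
      proof (rule dual_unit_sphereI)
        show "F (y + z) = F y + F z" for y z
          using f(1) g(1) proj_in by (simp add: F_def proj_add algebra_simps)
        show "F (smul t y) = t * F y" for t y
          using f(2) g(2) proj_in by (simp add: F_def proj_smul algebra_simps)
        show "norm (F y) \<le> norm y" for y
        proof -
          have "norm (F y) \<le> norm (of_real (fst c) * f (proj1 y)) + norm (of_real (snd c) * g (proj2 y))"
            unfolding F_def by (rule norm_triangle_ineq)
          also have "\<dots> \<le> fst c * norm (proj1 y) + snd c * norm (proj2 y)"
            unfolding norm_mult norm_of_real
            using f(3)[OF proj_in(1)] g(3)[OF proj_in(2)] c0 by (auto intro!: add_mono mult_left_mono)
          also have "\<dots> \<le> p (norm (proj1 y), norm (proj2 y))"
            using c by (auto simp: dual_ball_def)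
          finally show ?thesis using norm_eq_p[of y] by simp
        qed
      qed (use z[OF j] in auto)
    qed
    then show "\<exists>A z. (\<forall>k\<in>A. z k \<in> UNIV \<inter> sphere 0 1) \<and> (\<Sum>\<^sub>\<infinity>k\<in>A. \<alpha> k) > 1 - \<epsilon> \<and>
        (\<forall>k\<in>A. norm (z k - x k) < \<epsilon>) \<and> (\<exists>f\<in>dual_unit_sphere smul UNIV. \<forall>k\<in>A. f (z k) = 1)"
      using z A by (intro exI[of _ A] exI[of _ "\<lambda>k. m k + n k"]) auto
  qed
  then show "\<exists>\<eta>>0. \<eta> < \<epsilon> \<and> AHSp_for smul UNIV \<epsilon> \<eta>"
    using \<eta> e by (intro exI[of _ \<eta>]) (auto simp: e_def)
qed

section \<open>Symmetry in the summands and the equivalence\<close>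

lemma subspace_unit_vector:
  assumes "subspace Y" and "Y \<noteq> {0}"
  obtains y where "y \<in> Y" and "norm y = 1"
proof -
  obtain y where y: "y \<in> Y" "y \<noteq> 0" using assms subspace_0 by blast
  then show thesis
    using that[of "(1 / norm y) *\<^sub>R y"] assms(1) by (simp add: subspace_scaleR)
qed

text \<open>Exchanging the coordinates of \<open>p\<close> transfers to \<open>N\<close> what is
  proved for \<open>M\<close>.\<close>

lemma swap: "absolute_sum smul (p \<circ> prod.swap) N M"
proof (unfold_locales)
  show "absolute_norm (p \<circ> prod.swap)"
    unfolding absolute_norm_def is_norm_def o_def
  proof (intro conjI allI)
    fix v w :: "real \<times> real" and c r s :: real
    show "0 \<le> p (prod.swap v)" by (rule p_nonneg)
    show "p (prod.swap v) = 0 \<longleftrightarrow> v = 0" by (cases v) (auto simp: p_eq_0_iff zero_prod_def)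
    show "p (prod.swap (c *\<^sub>R v)) = \<bar>c\<bar> * p (prod.swap v)"
      using p_scaleR[of c "prod.swap v"] by (cases v) simp
    show "p (prod.swap (v + w)) \<le> p (prod.swap v) + p (prod.swap w)"
      using p_triangle[of "prod.swap v" "prod.swap w"] by (cases v; cases w) simp
    show "p (prod.swap (r, s)) = p (prod.swap (\<bar>r\<bar>, \<bar>s\<bar>))" using p_abs[of s r] by simp
  qed
  show "normalized_norm (p \<circ> prod.swap)"
    using normalized by (simp add: normalized_norm_def)
  show "direct_sum_decomposition smul N M"
  proof -
    have "x \<in> {m + n | m n. m \<in> N \<and> n \<in> M}" for x
      using proj_in[of x] proj_sum[of x] add.commute[of "proj1 x"] by force
    then have "{m + n | m n. m \<in> N \<and> n \<in> M} = UNIV" by blast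
    then show ?thesis
      using decomposition by (simp add: direct_sum_decomposition_def Int_commute)
  qed
  show "norm (m + n) = (p \<circ> prod.swap) (norm m, norm n)" if "m \<in> N" "n \<in> M" for m n
    using norm_sum[OF that(2,1)] by (simp add: add.commute)
qed

lemma AHSp_iff: "AHSp smul UNIV \<longleftrightarrow> AHSp smul M \<and> AHSp smul N"
proof
  assume "AHSp smul UNIV"
  then show "AHSp smul M \<and> AHSp smul N"
    using AHSp_summand absolute_sum.AHSp_summand[OF swap] by blast
next
  assume *: "AHSp smul M \<and> AHSp smul N"
  \<comment> \<open>A trivial summand has no unit vector to start from, but the other summand is
    then the whole space.\<close>
  consider "M = {0}" | "N = {0}" | "M \<noteq> {0}" "N \<noteq> {0}" by blast
  then show "AHSp smul UNIV"
  proof cases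
    case 1
    then show ?thesis using * UNIV_eq_if_trivial by simp
  next
    case 2
    then show ?thesis using * absolute_sum.UNIV_eq_if_trivial[OF swap] by simp
  next
    case 3
    then show ?thesis
      using * subspaces by (metis subspace_unit_vector AHSp_sum_nontrivial)
  qed
qed

end

theorem theorem2p6:
  fixes p :: "real \<times> real \<Rightarrow> real"
    and smul :: "'k::real_or_complex \<Rightarrow> 'a::banach \<Rightarrow> 'a"
    and M N :: "'a set"
  assumes "absolute_norm p" and "normalized_norm p"
    and "banach_space_over smul"
    and "direct_sum_decomposition smul M N"
    and "\<And>m n. m \<in> M \<Longrightarrow> n \<in> N \<Longrightarrow> norm (m + n) = p (norm m, norm n)"
  shows "(AHSp smul UNIV \<longleftrightarrow> AHSp smul M \<and> AHSp smul N) \<and>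
         (AHSp smul UNIV \<longrightarrow> (\<exists>\<eta>. AHSp_with smul M \<eta> \<and> AHSp_with smul N \<eta>))"
proof -
  interpret absolute_sum smul p M N
    using assms by (intro absolute_sum.intro absolute_normalized.intro absolute_sum_axioms.intro)
  show ?thesis using AHSp_iff AHSp_common_function by blast
qed

end
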